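(* Let $(W,S)$ be any Coxeter system and $s\in S$. Let $W_\Omega$ be the subgroup of the centralizer $C_W(s)$ generated by all the reflections it contains except $s$. Let $\Gamma_\Omega$ be the subgroup of $W$ generated by the elements $p_\gamma$, where $\gamma$ varies over the edge-loops in $\Delta^{\rm odd}$ based at $s$. Then: (1) The set of elements of $W$ of the form $r_{\gamma,u}$, where $\gamma$ is an edge-path in $\Delta^{\rm odd}$ starting at $s$ (and $u\in S$ is evenly joined to the endpoint of $\gamma$), forms a Coxeter system for $W_\Omega$. (2) The map $\pi_1(\Delta^{\rm odd},s)\to W$ given by $\gamma\mapsto p_\gamma$ is an isomorphism onto $\Gamma_\Omega$. (3) $C_W(s)=\langle s\rangle\times(W_\Omega\rtimes\Gamma_\Omega)$.
   Context: A Coxeter system $(W,S)$ is a group $W$ with a generating set $S$ (possibly infinite) of involutions such that the relations $(ss')^{o(ss')}=1$ ($s,s'\in S$) present $W$, where $o(ss')$ is the order of $ss'$ (no relation if it is $\infty$). A reflection in $W$ is an element conjugate into $S$. Distinct $t,u\in S$ are "evenly joined" if $o(tu)$ is finite and even (including $2$). The odd Coxeter diagram $\Delta^{\rm odd}$ is the graph with vertex set $S$ and distinct $s,s'$ joined iff $o(ss')$ is finite and odd. For an edge-path $\gamma=(t_0,\dots,t_n)$ in $\Delta^{\rm odd}$, with $2l_i+1=o(t_{i-1}t_i)$, set $p_\gamma:=(t_1t_0)^{l_1}(t_2t_1)^{l_2}\cdots(t_nt_{n-1})^{l_n}$, with $p_\gamma=1$ if $n=0$. If $u\in S$ is evenly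 joined to $t_n$, with $o(ut_n)=2\lambda$, set $r_{\gamma,u}:=p_\gamma\cdot(ut_n)^{\lambda-1}u\cdot p_\gamma^{-1}$. Different pairs $(\gamma,u)$ may give the same element $r_{\gamma,u}$; the Coxeter system consists of the set of group elements of this form. *)

theory Defs
  imports "HOL-Algebra.Generated_Groups" "HOL-Algebra.Multiplicative_Group"
begin

section \<open>Group presentations and Coxeter systems\<close>

text \<open>A word is a list of signed generators: \<open>(x, True)\<close> stands for \<open>x\<close> and
  \<open>(x, False)\<close> for the formal inverse of \<open>x\<close>.\<close>

primrec word_value :: "('a, 'b) monoid_scheme \<Rightarrow> ('a \<times> bool) list \<Rightarrow> 'a" where
  "word_value G [] = \<one>\<^bsub>G\<^esub>"
| "word_value G (l # w) =
     (if snd l then fst l else inv\<^bsub>G\<^esub> (fst l)) \<otimes>\<^bsub>G\<^esub> word_value G w"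

inductive word_step :: "'a set \<Rightarrow> ('a \<times> bool) list set \<Rightarrow>
    ('a \<times> bool) list \<Rightarrow> ('a \<times> bool) list \<Rightarrow> bool"
  for X R where
  cancel: "x \<in> X \<Longrightarrow> word_step X R (u @ [(x, b), (x, \<not> b)] @ v) (u @ v)"
| relator: "r \<in> R \<Longrightarrow> word_step X R (u @ r @ v) (u @ v)"

text \<open>\<open>X\<close> generates \<open>G\<close>, the relators in \<open>R\<close> hold in \<open>G\<close>, and every word over \<open>X\<close> that
  is trivial in \<open>G\<close> is trivial modulo free cancellation and the relators. The words over
  \<open>X\<close> modulo \<open>word_step X R\<close> form the quotient of the free group on \<open>X\<close> by the normal
  closure of \<open>R\<close>.\<close>

definition presents :: "('a, 'b) monoid_scheme \<Rightarrow> 'a set \<Rightarrow> ('a \<times> bool) list set \<Rightarrow> bool" where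
  "presents G X R \<longleftrightarrow>
     X \<subseteq> carrier G \<and> generate G X = carrier G \<and> R \<subseteq> lists (X \<times> UNIV) \<and>
     (\<forall>w \<in> lists (X \<times> UNIV). word_value G w = \<one>\<^bsub>G\<^esub> \<longleftrightarrow> equivclp (word_step X R) w [])"

text \<open>\<open>group.ord\<close> is \<open>0\<close> on elements of infinite order, for which the relator below is
  therefore the empty word.\<close>

definition coxeter_relators :: "('a, 'b) monoid_scheme \<Rightarrow> 'a set \<Rightarrow> ('a \<times> bool) list set" where
  "coxeter_relators G S =
     {concat (replicate (group.ord G (s \<otimes>\<^bsub>G\<^esub> s')) [(s, True), (s', True)]) | s s'.
        s \<in> S \<and> s' \<in> S}"

definition coxeter_system :: "('a, 'b) monoid_scheme \<Rightarrow> 'a set \<Rightarrow> bool" where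
  "coxeter_system G S \<longleftrightarrow>
     group G \<and> S \<subseteq> carrier G \<and>
     (\<forall>s \<in> S. s \<noteq> \<one>\<^bsub>G\<^esub> \<and> s \<otimes>\<^bsub>G\<^esub> s = \<one>\<^bsub>G\<^esub>) \<and>
     presents G S (coxeter_relators G S)"

definition reflections :: "('a, 'b) monoid_scheme \<Rightarrow> 'a set \<Rightarrow> 'a set" where
  "reflections G S = {g \<otimes>\<^bsub>G\<^esub> s \<otimes>\<^bsub>G\<^esub> inv\<^bsub>G\<^esub> g | g s. g \<in> carrier G \<and> s \<in> S}"

definition centralizer :: "('a, 'b) monoid_scheme \<Rightarrow> 'a \<Rightarrow> 'a set" where
  "centralizer G x = {g \<in> carrier G. g \<otimes>\<^bsub>G\<^esub> x = x \<otimes>\<^bsub>G\<^esub> g}"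


section \<open>Internal products\<close>

definition internal_direct_product ::
    "('a, 'b) monoid_scheme \<Rightarrow> 'a set \<Rightarrow> 'a set \<Rightarrow> 'a set \<Rightarrow> bool" where
  "internal_direct_product G K A B \<longleftrightarrow>
     subgroup K G \<and> A \<lhd> (G\<lparr>carrier := K\<rparr>) \<and> B \<lhd> (G\<lparr>carrier := K\<rparr>) \<and>
     A <#>\<^bsub>G\<^esub> B = K \<and> A \<inter> B = {\<one>\<^bsub>G\<^esub>}"

text \<open>\<open>K\<close> is the internal semidirect product of its normal subgroup \<open>N\<close> and its subgroup \<open>H\<close>.\<close>

definition internal_semidirect_product ::
    "('a, 'b) monoid_scheme \<Rightarrow> 'a set \<Rightarrow> 'a set \<Rightarrow> 'a set \<Rightarrow> bool" where
  "internal_semidirect_product G K N H \<longleftrightarrow>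
     subgroup K G \<and> N \<lhd> (G\<lparr>carrier := K\<rparr>) \<and> subgroup H (G\<lparr>carrier := K\<rparr>) \<and>
     N <#>\<^bsub>G\<^esub> H = K \<and> N \<inter> H = {\<one>\<^bsub>G\<^esub>}"


section \<open>Edge-paths and the fundamental group of a graph\<close>

text \<open>A graph has vertex set \<open>V\<close> and a symmetric irreflexive adjacency relation \<open>E\<close> on \<open>V\<close>.
  An edge-path is the nonempty list of the vertices it visits. The fundamental group is the
  edge-path group: edge-loops modulo insertion and deletion of backtracks.\<close>

definition edge_path :: "'a set \<Rightarrow> ('a \<Rightarrow> 'a \<Rightarrow> bool) \<Rightarrow> 'a list \<Rightarrow> bool" where
  "edge_path V E \<gamma> \<longleftrightarrow> \<gamma> \<noteq> [] \<and> set \<gamma> \<subseteq> V \<and> successively E \<gamma>"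

definition edge_loops :: "'a set \<Rightarrow> ('a \<Rightarrow> 'a \<Rightarrow> bool) \<Rightarrow> 'a \<Rightarrow> 'a list set" where
  "edge_loops V E v = {\<gamma>. edge_path V E \<gamma> \<and> hd \<gamma> = v \<and> last \<gamma> = v}"

inductive backtrack_step :: "('a \<Rightarrow> 'a \<Rightarrow> bool) \<Rightarrow> 'a list \<Rightarrow> 'a list \<Rightarrow> bool"
  for E where
  "E a b \<Longrightarrow> backtrack_step E (xs @ [a, b, a] @ ys) (xs @ [a] @ ys)"

definition loop_homotopy :: "'a set \<Rightarrow> ('a \<Rightarrow> 'a \<Rightarrow> bool) \<Rightarrow> 'a \<Rightarrow> ('a list \<times> 'a list) set" where
  "loop_homotopy V E v =
     {(\<gamma>, \<delta>). \<gamma> \<in> edge_loops V E v \<and> \<delta> \<in> edge_loops V E v \<and>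
        equivclp (backtrack_step E) \<gamma> \<delta>}"

definition loop_class :: "'a set \<Rightarrow> ('a \<Rightarrow> 'a \<Rightarrow> bool) \<Rightarrow> 'a \<Rightarrow> 'a list \<Rightarrow> 'a list set" where
  "loop_class V E v \<gamma> = loop_homotopy V E v `` {\<gamma>}"

text \<open>The tail in the product drops the duplicate base point when concatenating two loops.\<close>

definition graph_fundamental_group ::
    "'a set \<Rightarrow> ('a \<Rightarrow> 'a \<Rightarrow> bool) \<Rightarrow> 'a \<Rightarrow> 'a list set monoid" where
  "graph_fundamental_group V E v =
     \<lparr>carrier = edge_loops V E v // loop_homotopy V E v,
      mult = (\<lambda>A B. \<Union>\<gamma>\<in>A. \<Union>\<delta>\<in>B. loop_class V E v (\<gamma> @ tl \<delta>)),
      one = loop_class V E v [v]\<rparr>"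


section \<open>The odd Coxeter diagram and the elements of the centralizer\<close>

text \<open>Oddness of \<open>group.ord\<close> includes finiteness of the order, evenness does not.\<close>

definition odd_joined :: "('a, 'b) monoid_scheme \<Rightarrow> 'a set \<Rightarrow> 'a \<Rightarrow> 'a \<Rightarrow> bool" where
  "odd_joined G S t u \<longleftrightarrow>
     t \<in> S \<and> u \<in> S \<and> t \<noteq> u \<and> odd (group.ord G (t \<otimes>\<^bsub>G\<^esub> u))"

definition evenly_joined :: "('a, 'b) monoid_scheme \<Rightarrow> 'a set \<Rightarrow> 'a \<Rightarrow> 'a \<Rightarrow> bool" where
  "evenly_joined G S t u \<longleftrightarrow>
     t \<in> S \<and> u \<in> S \<and> t \<noteq> u \<and>
     group.ord G (t \<otimes>\<^bsub>G\<^esub> u) > 0 \<and> even (group.ord G (t \<otimes>\<^bsub>G\<^esub> u))"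

text \<open>For an odd order \<open>2 l + 1\<close>, division by two gives \<open>l\<close>.\<close>

fun path_elt :: "('a, 'b) monoid_scheme \<Rightarrow> 'a list \<Rightarrow> 'a" where
  "path_elt G (t0 # t1 # ts) =
     (t1 \<otimes>\<^bsub>G\<^esub> t0) [^]\<^bsub>G\<^esub> (group.ord G (t0 \<otimes>\<^bsub>G\<^esub> t1) div 2) \<otimes>\<^bsub>G\<^esub> path_elt G (t1 # ts)"
| "path_elt G _ = \<one>\<^bsub>G\<^esub>"

definition path_reflection :: "('a, 'b) monoid_scheme \<Rightarrow> 'a list \<Rightarrow> 'a \<Rightarrow> 'a" where
  "path_reflection G \<gamma> u =
     path_elt G \<gamma> \<otimes>\<^bsub>G\<^esub>
     ((u \<otimes>\<^bsub>G\<^esub> last \<gamma>) [^]\<^bsub>G\<^esub> (group.ord G (u \<otimes>\<^bsub>G\<^esub> last \<gamma>) div 2 - 1) \<otimes>\<^bsub>G\<^esub> u) \<otimes>\<^bsub>G\<^esub>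
     inv\<^bsub>G\<^esub> (path_elt G \<gamma>)"

definition path_reflections :: "('a, 'b) monoid_scheme \<Rightarrow> 'a set \<Rightarrow> 'a \<Rightarrow> 'a set" where
  "path_reflections G S s =
     {path_reflection G \<gamma> u | \<gamma> u.
        edge_path S (odd_joined G S) \<gamma> \<and> hd \<gamma> = s \<and> evenly_joined G S (last \<gamma>) u}"

definition W_Omega :: "('a, 'b) monoid_scheme \<Rightarrow> 'a set \<Rightarrow> 'a \<Rightarrow> 'a set" where
  "W_Omega G S s = generate G (reflections G S \<inter> centralizer G s - {s})"

definition Gamma_Omega :: "('a, 'b) monoid_scheme \<Rightarrow> 'a set \<Rightarrow> 'a \<Rightarrow> 'a set" where
  "Gamma_Omega G S s = generate G (path_elt G ` edge_loops S (odd_joined G S) s)"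

end

theory Submission
  imports Defs
begin

text \<open>Let \<open>N w\<close> be the set of reflections whose wall separates \<open>1\<close> from \<open>w\<close>; it satisfies the
  cocycle rule \<open>N (x y) = N x \<triangle> x (N y) x\<inverse>\<close> and \<open>N r = {r}\<close> for generators. Any
  group generated by involutions and carrying such a cocycle has the exchange property and hence,
  by Matsumoto's argument, is a Coxeter system. For \<open>(W, S)\<close> itself, \<open>N\<close> is read off from the
  presentation.

  If \<open>a w = w b\<close> with \<open>a, b\<close> simple and \<open>a \<notin> N w\<close>, and \<open>u\<close> is a left descent of \<open>w\<close>, then the
  factor of \<open>w\<close> in the dihedral group of \<open>a\<close> and \<open>u\<close> is its longest element without the final
  letter: an odd edge from \<open>a\<close> to \<open>u\<close>, or a reflection commuting with \<open>a\<close> if the order of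
  \<open>a u\<close> is even. By induction on length, the elements of the centralizer of \<open>s\<close> with \<open>s \<notin> N w\<close>
  are the products of path reflections and one path element. Intersecting \<open>N\<close> with the
  reflections different from \<open>s\<close> that commute with \<open>s\<close> gives a cocycle that is \<open>{r}\<close> on each path
  reflection \<open>r\<close> and empty on each path element. So the path reflections form a Coxeter system,
  and the group they generate contains all those reflections and meets the path elements
  trivially. Finally, a path without backtracks is recovered from its path element, whose only
  left descent is the second vertex of the path.\<close>

section \<open>Groups with a reflection cocycle\<close>

text \<open>A path reflection may be a long element of \<open>W\<close>, so lengths in
  \<open>W\<close> do not show that path reflections satisfy the Coxeter relations only. What passes
  to \<open>W_Omega\<close> is the cocycle: conjugation by the centralizer of \<open>s\<close>
  permutes the reflections commuting with \<open>s\<close>, so cutting \<open>N\<close> down to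
  these keeps the cocycle rule. Hence the theory from exchange to Matsumoto is written for an
  abstract \<open>N\<close> and serves both \<open>W\<close> and \<open>W_Omega\<close>. The
  exponents in the elements p and r have one source: with m the order of u a, take the alternating
  word of length m - 1 that starts with u. For m = 2 l + 1 it is (u a)^l; for m = 2 \<lambda> it is
  (u a)^(\<lambda> - 1) u, which is then its only inversion commuting with a. For (2) the obstacle
  is to exclude relations between path elements. That a path element has a single descent takes an
  argument in rank three, about the start a of the path and two supposed descents.\<close>

fun alternating :: "'a \<Rightarrow> 'a \<Rightarrow> nat \<Rightarrow> 'a list" where
  "alternating a b 0 = []"
| "alternating a b (Suc n) = a # alternating b a n"

lemma length_alternating [simp]: "length (alternating a b n) = n"
  by (induction a b n rule: alternating.induct) auto

lemma set_alternating: "set (alternating a b n) \<subseteq> {a, b}"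
  by (induction a b n rule: alternating.induct) auto

lemma alternating_append:
  "alternating a b (m + n) =
    alternating a b m @ (if even m then alternating a b n else alternating b a n)"
  by (induction a b m rule: alternating.induct) auto

lemma rev_alternating:
  "rev (alternating a b n) = (if even n then alternating b a n else alternating a b n)"
proof (induction n)
  case (Suc n)
  have "alternating a b (Suc n) = alternating a b n @ (if even n then [a] else [b])"
    using alternating_append[of a b n 1] by simp
  with Suc show ?case by simp
qed simp

lemma alternatingI:
  assumes "successively (\<noteq>) (a # ws)" "set ws \<subseteq> {a, b}"
  shows "a # ws = alternating a b (Suc (length ws))"
  using assms
proof (induction ws arbitrary: a b)
  case (Cons c ws)
  then have "c = b" "set ws \<subseteq> {b, a}" "successively (\<noteq>) (b # ws)" by auto
  with Cons.IH[of b a] show ?case by simp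
qed simp

text \<open>Generators are involutions, so unsigned letters suffice for the combinatorics;
  \<open>word_equiv_unsign\<close> later removes the signs that presentations require.\<close>

definition word_prod :: "('a, 'b) monoid_scheme \<Rightarrow> 'a list \<Rightarrow> 'a" where
  "word_prod G ws = foldr (\<otimes>\<^bsub>G\<^esub>) ws \<one>\<^bsub>G\<^esub>"

lemma word_prod_simps [simp]:
  "word_prod G [] = \<one>\<^bsub>G\<^esub>"
  "word_prod G (w # ws) = w \<otimes>\<^bsub>G\<^esub> word_prod G ws"
  by (simp_all add: word_prod_def)

context group
begin

lemma inv_mult_cancel [simp]:
  assumes "x \<in> carrier G" "y \<in> carrier G"
  shows "inv x \<otimes> (x \<otimes> y) = y" "x \<otimes> (inv x \<otimes> y) = y"
  using assms by (simp_all flip: m_assoc)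

lemma word_prod_closed [simp]: "set ws \<subseteq> carrier G \<Longrightarrow> word_prod G ws \<in> carrier G"
  by (induction ws) auto

lemma word_prod_append:
  "set us \<subseteq> carrier G \<Longrightarrow> set vs \<subseteq> carrier G \<Longrightarrow>
    word_prod G (us @ vs) = word_prod G us \<otimes> word_prod G vs"
  by (induction us) (auto simp: m_assoc)

lemma word_prod_in_generate: "set ws \<subseteq> J \<Longrightarrow> word_prod G ws \<in> generate G J"
  by (induction ws) (auto intro: generate.intros)

lemma word_prod_alternating_even:
  assumes "a \<in> carrier G" "b \<in> carrier G"
  shows "word_prod G (alternating a b (2 * n)) = (a \<otimes> b) [^] n"
proof (induction n)
  case (Suc n)
  then show ?case using assms nat_pow_Suc2[of "a \<otimes> b" n] by (simp add: m_assoc)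
qed simp

lemma word_prod_alternating_odd:
  assumes "a \<in> carrier G" "b \<in> carrier G"
  shows "word_prod G (alternating a b (Suc (2 * n))) = (a \<otimes> b) [^] n \<otimes> a"
proof -
  have "alternating a b (2 * n + 1) = alternating a b (2 * n) @ [a]"
    by (subst alternating_append) simp
  moreover have "set (alternating a b (2 * n)) \<subseteq> carrier G"
    using assms set_alternating[of a b "2 * n"] by blast
  ultimately show ?thesis
    using assms word_prod_alternating_even[OF assms] by (simp add: word_prod_append del: alternating.simps)
qed

lemma normal_subgroupI:
  assumes K: "subgroup K G" and H: "subgroup H G" "H \<subseteq> K"
    and conj: "\<And>x h. x \<in> K \<Longrightarrow> h \<in> H \<Longrightarrow> x \<otimes> h \<otimes> inv x \<in> H"
  shows "H \<lhd> (G\<lparr>carrier := K\<rparr>)"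
proof -
  interpret K: group "G\<lparr>carrier := K\<rparr>" by (rule subgroup.subgroup_is_group[OF K is_group])
  show ?thesis
    using subgroup_incl[OF H(1) K H(2)] conj m_inv_consistent[OF K] by (intro K.normal_invI) auto
qed

end

locale involution_generated = group G for G (structure) +
  fixes R :: "'a set"
  assumes R_closed: "R \<subseteq> carrier G"
    and R_generate: "generate G R = carrier G"
    and R_square: "r \<in> R \<Longrightarrow> r \<otimes> r = \<one>"
begin

lemma R_carrier [simp]: "r \<in> R \<Longrightarrow> r \<in> carrier G"
  using R_closed by blast

lemma R_inv [simp]: "r \<in> R \<Longrightarrow> inv r = r"
  using R_square inv_equality by simp

lemma R_cancel [simp]: "r \<in> R \<Longrightarrow> y \<in> carrier G \<Longrightarrow> r \<otimes> (r \<otimes> y) = y"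
  using inv_mult_cancel(1)[of r y] by simp

declare R_square [simp]

lemma set_R_carrier: "set ws \<subseteq> R \<Longrightarrow> set ws \<subseteq> carrier G"
  using R_closed by blast

lemma word_prod_R [simp]: "set ws \<subseteq> R \<Longrightarrow> word_prod G ws \<in> carrier G"
  by (simp add: set_R_carrier)

lemma word_prod_rev:
  "set ws \<subseteq> R \<Longrightarrow> word_prod G (rev ws) = inv (word_prod G ws)"
  by (induction ws) (auto simp: word_prod_append set_R_carrier inv_mult_group)

lemma generate_word:
  assumes "J \<subseteq> R" "x \<in> generate G J"
  obtains ws where "set ws \<subseteq> J" "word_prod G ws = x"
proof -
  from assms(2) have "\<exists>ws. set ws \<subseteq> J \<and> word_prod G ws = x"
  proof induction
    case one
    then show ?case by (intro exI[of _ "[]"]) simp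
  next
    case (incl h)
    then show ?case using assms(1) by (intro exI[of _ "[h]"]) auto
  next
    case (inv h)
    then show ?case using assms(1) by (intro exI[of _ "[h]"]) auto
  next
    case (eng h1 h2)
    then obtain us vs where "set us \<subseteq> J" "word_prod G us = h1" "set vs \<subseteq> J" "word_prod G vs = h2"
      by blast
    then show ?case using assms(1)
      by (intro exI[of _ "us @ vs"]) (simp add: word_prod_append set_R_carrier)
  qed
  then show ?thesis using that by blast
qed

lemma carrier_word:
  assumes "x \<in> carrier G"
  obtains ws where "set ws \<subseteq> R" "word_prod G ws = x"
  using generate_word[of R x] assms R_generate by blast

lemma generate_subgroup: "J \<subseteq> R \<Longrightarrow> subgroup (generate G J) G"
  using generate_is_subgroup R_closed by (metis order_trans)

lemma generate_carrier: "J \<subseteq> R \<Longrightarrow> x \<in> generate G J \<Longrightarrow> x \<in> carrier G"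
  using generate_subgroup subgroup.mem_carrier by metis

lemma ord_commute:
  assumes "a \<in> R" "b \<in> R"
  shows "ord (b \<otimes> a) = ord (a \<otimes> b)"
  using ord_inv[of "a \<otimes> b"] assms by (simp add: inv_mult_group)

lemma alternating_R: "a \<in> R \<Longrightarrow> b \<in> R \<Longrightarrow> set (alternating a b n) \<subseteq> R"
  using set_alternating[of a b n] by auto

lemma alternating_mult_inv:
  assumes "a \<in> R" "b \<in> R"
  shows "word_prod G (alternating a b n) \<otimes> inv (word_prod G (alternating b a n)) = (a \<otimes> b) [^] n"
proof -
  have "alternating a b n @ rev (alternating b a n) = alternating a b (2 * n)"
    by (simp add: rev_alternating mult_2 alternating_append)
  then show ?thesis
    using assms word_prod_alternating_even[of a b n] alternating_R[OF assms(2,1)] alternating_R[OF assms]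
      word_prod_append[of "alternating a b n" "rev (alternating b a n)"]
    by (simp add: set_R_carrier word_prod_rev)
qed

text \<open>Dividing one word by the other leaves (a b)^n by \<open>alternating_mult_inv\<close>.
  For infinite order \<open>ord\<close> is 0, which divides only \<open>n = 0\<close>, as it
  should.\<close>

lemma alternating_eq_iff:
  assumes "a \<in> R" "b \<in> R"
  shows "word_prod G (alternating a b n) = word_prod G (alternating b a n) \<longleftrightarrow> ord (a \<otimes> b) dvd n"
proof -
  have "word_prod G (alternating a b n) = word_prod G (alternating b a n) \<longleftrightarrow> (a \<otimes> b) [^] n = \<one>"
    using alternating_mult_inv[OF assms, of n] alternating_R[OF assms(2,1), of n] alternating_R[OF assms, of n]
    by (metis inv_closed inv_inv inv_equality r_inv word_prod_R)
  then show ?thesis using assms by (simp add: pow_eq_id)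
qed

lemma mult_pow_swap:
  assumes "a \<in> R" "b \<in> R"
  shows "a \<otimes> (b \<otimes> a) [^] (n::nat) = (a \<otimes> b) [^] n \<otimes> a"
  using assms by (induction n) (simp_all add: m_assoc flip: m_assoc[of a "(b \<otimes> a) [^] _"])

end

text \<open>The cocycle rule is pointwise, with symmetric difference as inequality of truth values.
  Finiteness of \<open>N x\<close> is derived and no link between \<open>N\<close> and conjugates of
  generators is built in, so cutting all values of \<open>N\<close> down to a smaller set can give
  an instance again.\<close>

locale reflection_cocycle = involution_generated +
  fixes N :: "'a \<Rightarrow> 'a set"
  assumes N_closed: "x \<in> carrier G \<Longrightarrow> N x \<subseteq> carrier G"
    and N_generator: "r \<in> R \<Longrightarrow> N r = {r}"
    and N_mult: "x \<in> carrier G \<Longrightarrow> y \<in> carrier G \<Longrightarrow> t \<in> carrier G \<Longrightarrow>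
      t \<in> N (x \<otimes> y) \<longleftrightarrow> (t \<in> N x) \<noteq> (inv x \<otimes> t \<otimes> x \<in> N y)"
begin

text \<open>Length counts inversions; \<open>reduced_subword\<close> and
  \<open>len_word_prod_le\<close> identify it with the least number of letters in a word.\<close>

abbreviation len :: "'a \<Rightarrow> nat" where "len x \<equiv> card (N x)"

lemma N_one [simp]: "N \<one> = {}"
proof -
  have "t \<notin> N \<one>" if "t \<in> carrier G" for t
    using N_mult[of \<one> \<one> t] that by simp
  then show ?thesis using N_closed[of \<one>] by blast
qed

lemma R_neq_one: "r \<in> R \<Longrightarrow> r \<noteq> \<one>"
  using N_generator N_one by blast

lemma N_inv:
  assumes "x \<in> carrier G" "t \<in> carrier G"
  shows "t \<in> N (inv x) \<longleftrightarrow> x \<otimes> t \<otimes> inv x \<in> N x"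
  using N_mult[of "inv x" x t] assms by simp

lemma N_R_mult:
  assumes "r \<in> R" "x \<in> carrier G" "t \<in> carrier G"
  shows "t \<in> N (r \<otimes> x) \<longleftrightarrow> (t = r) \<noteq> (r \<otimes> t \<otimes> r \<in> N x)"
  using N_mult[of r x t] assms N_generator by simp

lemma R_mult_self_in_N:
  assumes "r \<in> R" "x \<in> carrier G"
  shows "r \<in> N (r \<otimes> x) \<longleftrightarrow> r \<notin> N x"
  using N_R_mult[of r x r] assms by simp

text \<open>The symmetric difference of disjoint sets is their union; this is the case in which
  lengths add.\<close>

lemma N_mult_eq:
  assumes "x \<in> carrier G" "y \<in> carrier G" "N x \<inter> (\<lambda>t. x \<otimes> t \<otimes> inv x) ` N y = {}"
  shows "N (x \<otimes> y) = N x \<union> (\<lambda>t. x \<otimes> t \<otimes> inv x) ` N y"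
proof (intro equalityI subsetI)
  fix t assume t: "t \<in> N (x \<otimes> y)"
  then have tc: "t \<in> carrier G" using N_closed[of "x \<otimes> y"] assms(1,2) by auto
  have "t = x \<otimes> (inv x \<otimes> t \<otimes> x) \<otimes> inv x" using tc assms(1,2) by (simp add: m_assoc)
  then show "t \<in> N x \<union> (\<lambda>t. x \<otimes> t \<otimes> inv x) ` N y"
    using N_mult[OF assms(1,2) tc] t by blast
next
  fix t assume t: "t \<in> N x \<union> (\<lambda>t. x \<otimes> t \<otimes> inv x) ` N y"
  then have tc: "t \<in> carrier G" using N_closed[of x] N_closed[of y] assms(1,2) by auto
  have "inv x \<otimes> t \<otimes> x \<in> N y \<longleftrightarrow> t \<in> (\<lambda>t. x \<otimes> t \<otimes> inv x) ` N y"
  proof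
    assume "inv x \<otimes> t \<otimes> x \<in> N y"
    moreover have "t = x \<otimes> (inv x \<otimes> t \<otimes> x) \<otimes> inv x" using tc assms(1,2) by (simp add: m_assoc)
    ultimately show "t \<in> (\<lambda>t. x \<otimes> t \<otimes> inv x) ` N y" by blast
  next
    assume "t \<in> (\<lambda>t. x \<otimes> t \<otimes> inv x) ` N y"
    then obtain t' where t': "t' \<in> N y" "t = x \<otimes> t' \<otimes> inv x" by blast
    moreover have "t' \<in> carrier G" using t' N_closed[OF assms(2)] by blast
    ultimately show "inv x \<otimes> t \<otimes> x \<in> N y" using assms(1) by (simp add: m_assoc)
  qed
  then show "t \<in> N (x \<otimes> y)"
    using N_mult[OF assms(1,2) tc] t assms(3) by blast
qed

section \<open>Exchange, length and reduced words\<close>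

lemma inj_on_conj: "x \<in> carrier G \<Longrightarrow> A \<subseteq> carrier G \<Longrightarrow> inj_on (\<lambda>t. x \<otimes> t \<otimes> inv x) A"
  by (intro inj_onI) (auto simp: subset_iff)

text \<open>Either \<open>t\<close> is the first letter, which is deleted, or the conjugate of
  \<open>t\<close> by that letter is an inversion of the rest. Keeping the letters within
  \<open>set ws\<close> is what later confines inversions to parabolic subgroups.\<close>

lemma strong_exchange_word:
  assumes "set ws \<subseteq> R" "t \<in> N (word_prod G ws)"
  shows "\<exists>us. set us \<subseteq> set ws \<and> length ws = Suc (length us) \<and> word_prod G us = t \<otimes> word_prod G ws"
  using assms
proof (induction ws arbitrary: t)
  case (Cons r ws)
  have tc: "t \<in> carrier G" using N_closed[of "word_prod G (r # ws)"] Cons.prems by auto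
  show ?case
  proof (cases "t = r")
    case True
    then show ?thesis using Cons.prems by (intro exI[of _ ws]) auto
  next
    case False
    then have "r \<otimes> t \<otimes> r \<in> N (word_prod G ws)"
      using N_R_mult[of r "word_prod G ws" t] Cons.prems tc by simp
    then obtain us where us: "set us \<subseteq> set ws" "length ws = Suc (length us)"
      "word_prod G us = r \<otimes> t \<otimes> r \<otimes> word_prod G ws"
      using Cons.IH[of "r \<otimes> t \<otimes> r"] Cons.prems(1) by auto
    then show ?thesis using Cons.prems tc
      by (intro exI[of _ "r # us"] conjI) (simp_all add: m_assoc subset_insertI2)
  qed
qed simp

text \<open>By exchange, \<open>t\<close> is the quotient of two words over
  \<open>J\<close>.\<close>

lemma N_word_prod_subset:
  assumes "set ws \<subseteq> J" "J \<subseteq> R"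
  shows "N (word_prod G ws) \<subseteq> generate G J"
proof
  fix t assume t: "t \<in> N (word_prod G ws)"
  then obtain us where us: "set us \<subseteq> set ws" "word_prod G us = t \<otimes> word_prod G ws"
    using strong_exchange_word assms by (metis order_trans)
  have c: "t \<in> carrier G" "word_prod G ws \<in> carrier G"
    using t N_closed[of "word_prod G ws"] assms by auto
  have sg: "subgroup (generate G J) G"
    using generate_is_subgroup assms(2) R_closed by (metis order_trans)
  have "t = word_prod G us \<otimes> inv (word_prod G ws)"
    using us c by (simp add: m_assoc)
  then show "t \<in> generate G J"
    using sg us assms word_prod_in_generate
    by (metis order_trans subgroup.m_closed subgroup.m_inv_closed)
qed

lemma finite_N_word: "set ws \<subseteq> R \<Longrightarrow> finite (N (word_prod G ws))"
proof (induction ws)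
  case (Cons r ws)
  let ?x = "word_prod G ws"
  have "N (r \<otimes> ?x) \<subseteq> insert r ((\<lambda>t. r \<otimes> t \<otimes> r) ` N ?x)"
  proof
    fix t assume t: "t \<in> N (r \<otimes> ?x)"
    then have tc: "t \<in> carrier G" using N_closed[of "r \<otimes> ?x"] Cons.prems by auto
    have "t = r \<otimes> (r \<otimes> t \<otimes> r) \<otimes> r" using tc Cons.prems by (simp add: m_assoc)
    then show "t \<in> insert r ((\<lambda>t. r \<otimes> t \<otimes> r) ` N ?x)"
      using N_R_mult[of r ?x t] t tc Cons.prems by auto
  qed
  then show ?case using Cons by (auto intro: finite_subset)
qed simp

lemma finite_N [simp]: "x \<in> carrier G \<Longrightarrow> finite (N x)"
  using carrier_word finite_N_word by metis

lemma len_R_mult_up: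
  assumes "r \<in> R" "x \<in> carrier G" "r \<notin> N x"
  shows "len (r \<otimes> x) = Suc (len x)"
proof -
  have notin: "r \<notin> (\<lambda>t. r \<otimes> t \<otimes> inv r) ` N x"
  proof
    assume "r \<in> (\<lambda>t. r \<otimes> t \<otimes> inv r) ` N x"
    then obtain t where t: "t \<in> N x" "r = r \<otimes> t \<otimes> r" using assms by auto
    then have "t \<in> carrier G" using N_closed assms by blast
    then have "r \<otimes> (r \<otimes> t \<otimes> r) \<otimes> r = t" using assms by (simp add: m_assoc)
    then have "r = t" unfolding t(2)[symmetric] using assms(1) by simp
    then show False using t assms by simp
  qed
  then have "N (r \<otimes> x) = insert r ((\<lambda>t. r \<otimes> t \<otimes> inv r) ` N x)"
    using N_mult_eq[of r x] assms N_generator by simp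
  then show ?thesis
    using notin assms inj_on_conj[of r "N x"] N_closed by (simp add: card_image)
qed

lemma len_R_mult_down:
  assumes "r \<in> R" "x \<in> carrier G" "r \<in> N x"
  shows "Suc (len (r \<otimes> x)) = len x"
  using len_R_mult_up[of r "r \<otimes> x"] R_mult_self_in_N[of r x] assms by simp

text \<open>Letters are added from the right end. When the next one would shorten the product,
  exchange deletes a letter from the word found so far instead.\<close>

lemma reduced_subword:
  assumes "set ws \<subseteq> R"
  shows "\<exists>us. set us \<subseteq> set ws \<and> word_prod G us = word_prod G ws \<and> length us = len (word_prod G ws)"
  using assms
proof (induction ws)
  case (Cons r ws)
  let ?x = "word_prod G ws"
  obtain us where us: "set us \<subseteq> set ws" "word_prod G us = ?x" "length us = len ?x"
    using Cons by auto
  show ?case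
  proof (cases "r \<in> N ?x")
    case True
    then have "r \<in> N (word_prod G us)" "set us \<subseteq> R" using us Cons.prems by auto
    then obtain vs where vs: "set vs \<subseteq> set us" "length us = Suc (length vs)"
      "word_prod G vs = r \<otimes> word_prod G us"
      using strong_exchange_word[of us r] by auto
    have "Suc (len (r \<otimes> ?x)) = len ?x" using len_R_mult_down True Cons.prems by simp
    then show ?thesis using us vs Cons.prems by (intro exI[of _ vs]) auto
  next
    case False
    then show ?thesis using us Cons.prems len_R_mult_up by (intro exI[of _ "r # us"]) auto
  qed
qed simp

definition reduced :: "'a list \<Rightarrow> bool" where
  "reduced ws \<longleftrightarrow> set ws \<subseteq> R \<and> length ws = len (word_prod G ws)"

lemma reduced_word_generate:
  assumes "J \<subseteq> R" "x \<in> generate G J"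
  obtains ws where "reduced ws" "set ws \<subseteq> J" "word_prod G ws = x"
proof -
  obtain ws where ws: "set ws \<subseteq> J" "word_prod G ws = x"
    using generate_word assms by blast
  then obtain us where "set us \<subseteq> set ws" "word_prod G us = word_prod G ws" "length us = len x"
    using reduced_subword[of ws] assms(1) by auto
  then show ?thesis using that[of us] ws assms by (auto simp: reduced_def)
qed

lemma reduced_word:
  assumes "x \<in> carrier G"
  obtains ws where "reduced ws" "word_prod G ws = x"
  using reduced_word_generate[of R x] assms R_generate by blast

lemma len_word_prod_le: "set ws \<subseteq> R \<Longrightarrow> len (word_prod G ws) \<le> length ws"
proof (induction ws)
  case (Cons r ws)
  then show ?case
    using len_R_mult_up[of r "word_prod G ws"] len_R_mult_down[of r "word_prod G ws"]
    by (cases "r \<in> N (word_prod G ws)") auto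
qed simp

lemma reduced_Cons:
  "reduced (r # ws) \<longleftrightarrow> r \<in> R \<and> reduced ws \<and> r \<notin> N (word_prod G ws)"
proof
  assume red: "reduced (r # ws)"
  then have R: "r \<in> R" "set ws \<subseteq> R" and l: "Suc (length ws) = len (r \<otimes> word_prod G ws)"
    by (auto simp: reduced_def)
  show "r \<in> R \<and> reduced ws \<and> r \<notin> N (word_prod G ws)"
  proof (cases "r \<in> N (word_prod G ws)")
    case True
    then show ?thesis
      using len_R_mult_down[of r "word_prod G ws"] len_word_prod_le[of ws] l R by simp
  next
    case False
    then show ?thesis
      using len_R_mult_up[of r "word_prod G ws"] l R by (simp add: reduced_def)
  qed
qed (auto simp: reduced_def len_R_mult_up)

lemma reduced_Nil [simp]: "reduced []"
  by (simp add: reduced_def)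

lemma reduced_drop: "reduced (us @ vs) \<Longrightarrow> reduced vs"
  by (induction us) (auto simp: reduced_Cons)

lemma len_mult_le:
  assumes "x \<in> carrier G" "y \<in> carrier G"
  shows "len (x \<otimes> y) \<le> len x + len y"
proof -
  obtain us vs where "reduced us" "word_prod G us = x" "reduced vs" "word_prod G vs = y"
    using reduced_word[OF assms(1)] reduced_word[OF assms(2)] by metis
  then show ?thesis using len_word_prod_le[of "us @ vs"]
    by (auto simp: reduced_def word_prod_append set_R_carrier)
qed

lemma N_mult_self_less:
  assumes "x \<in> carrier G" "t \<in> N x"
  shows "len (t \<otimes> x) < len x"
proof -
  obtain ws where ws: "reduced ws" "word_prod G ws = x" using reduced_word assms by blast
  then obtain us where "set us \<subseteq> set ws" "length ws = Suc (length us)" "word_prod G us = t \<otimes> x"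
    using strong_exchange_word[of ws t] assms unfolding reduced_def by blast
  moreover from this ws have "set us \<subseteq> R" unfolding reduced_def by blast
  ultimately show ?thesis using ws len_word_prod_le[of us] by (simp add: reduced_def)
qed

lemma len_R [simp]: "r \<in> R \<Longrightarrow> len r = 1"
  by (simp add: N_generator)

lemma len_eq_0D:
  assumes "x \<in> carrier G" "len x = 0"
  shows "x = \<one>"
  using reduced_word[OF assms(1)] assms(2) by (auto simp: reduced_def)

lemma descent_iff:
  assumes "r \<in> R" "x \<in> carrier G"
  shows "r \<in> N x \<longleftrightarrow> len (r \<otimes> x) < len x"
  using len_R_mult_up[OF assms] N_mult_self_less[OF assms(2), of r] by fastforce

subsection \<open>Parabolic subgroups\<close>

lemma N_generate_subset:
  assumes "J \<subseteq> R" "x \<in> generate G J"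
  shows "N x \<subseteq> generate G J"
  using generate_word[OF assms] N_word_prod_subset assms(1) by metis

text \<open>\<open>N d\<close> lies in the parabolic subgroup, while conjugation by \<open>d\<close>
  keeps \<open>N y\<close> outside it, so nothing cancels in the cocycle rule.\<close>

lemma N_parabolic_mult:
  assumes J: "J \<subseteq> R" and d: "d \<in> generate G J" and y: "y \<in> carrier G"
    and disj: "N y \<inter> generate G J = {}"
  shows "len (d \<otimes> y) = len d + len y" "N (d \<otimes> y) \<inter> generate G J = N d"
proof -
  interpret J: subgroup "generate G J" G using generate_subgroup J by blast
  have dc: "d \<in> carrier G" using d by simp
  have *: "d \<otimes> t \<otimes> inv d \<notin> generate G J" if "t \<in> N y" for t
  proof
    assume "d \<otimes> t \<otimes> inv d \<in> generate G J"
    then have "inv d \<otimes> (d \<otimes> t \<otimes> inv d) \<otimes> d \<in> generate G J" using d by blast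
    moreover have "t \<in> carrier G" using that N_closed y by blast
    ultimately have "t \<in> generate G J" using dc by (simp add: m_assoc)
    then show False using that disj by blast
  qed
  have sub: "N d \<subseteq> generate G J" using N_generate_subset J d by blast
  have disj': "N d \<inter> (\<lambda>t. d \<otimes> t \<otimes> inv d) ` N y = {}" using sub * by blast
  then have eq: "N (d \<otimes> y) = N d \<union> (\<lambda>t. d \<otimes> t \<otimes> inv d) ` N y"
    using N_mult_eq dc y by blast
  show "len (d \<otimes> y) = len d + len y"
    using eq disj' dc y inj_on_conj[OF dc N_closed[OF y]] by (simp add: card_Un_disjoint card_image)
  show "N (d \<otimes> y) \<inter> generate G J = N d" using eq sub * by blast
qed

text \<open>Choose \<open>e\<close> in the parabolic subgroup with \<open>e \<otimes> x\<close> as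
  short as possible: an inversion of \<open>e \<otimes> x\<close> in that subgroup would shorten it
  further.\<close>

lemma parabolic_decomposition:
  assumes J: "J \<subseteq> R" and x: "x \<in> carrier G"
  obtains d y where "d \<in> generate G J" "y \<in> carrier G" "x = d \<otimes> y" "N y \<inter> generate G J = {}"
proof -
  interpret J: subgroup "generate G J" G using generate_subgroup J by blast
  define P where "P e \<longleftrightarrow> e \<in> generate G J" for e
  have "P \<one>" by (simp add: P_def)
  then obtain e where e: "P e" "\<And>e'. P e' \<Longrightarrow> len (e \<otimes> x) \<le> len (e' \<otimes> x)"
    using ex_has_least_nat[of P \<one> "\<lambda>e. len (e \<otimes> x)"] by auto
  have ec: "e \<in> carrier G" using e by (auto simp: P_def)
  show ?thesis
  proof (rule that[of "inv e" "e \<otimes> x"])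
    show "inv e \<in> generate G J" using e by (auto simp: P_def)
    show "N (e \<otimes> x) \<inter> generate G J = {}"
    proof (rule equals0I)
      fix t assume t: "t \<in> N (e \<otimes> x) \<inter> generate G J"
      then have "len (t \<otimes> (e \<otimes> x)) < len (e \<otimes> x)" using N_mult_self_less ec x by simp
      moreover have "P (t \<otimes> e)" using t e by (auto simp: P_def)
      moreover have "t \<otimes> (e \<otimes> x) = t \<otimes> e \<otimes> x" using t ec x by (simp add: m_assoc)
      ultimately show False using e(2)[of "t \<otimes> e"] by simp
    qed
  qed (use ec x in \<open>simp_all add: m_assoc\<close>)
qed

lemma exists_descent:
  assumes J: "J \<subseteq> R" and d: "d \<in> generate G J" "d \<noteq> \<one>"
  shows "\<exists>j\<in>J. j \<in> N d"
proof -
  obtain ws where ws: "reduced ws" "set ws \<subseteq> J" "word_prod G ws = d"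
    using reduced_word_generate J d by blast
  then obtain r us where us: "ws = r # us" using d by (cases ws) auto
  then have "r \<in> N (r \<otimes> word_prod G us)"
    using ws J reduced_Cons[of r us] R_mult_self_in_N[of r "word_prod G us"] reduced_def by auto
  then show ?thesis using ws us by auto
qed

text \<open>The parabolic factor of \<open>x\<close> has no descent in \<open>J\<close>, hence is
  trivial. So it is enough to test generators.\<close>

lemma N_disjoint_parabolicI:
  assumes J: "J \<subseteq> R" and x: "x \<in> carrier G" and "N x \<inter> J = {}"
  shows "N x \<inter> generate G J = {}"
proof -
  obtain d y where dy: "d \<in> generate G J" "y \<in> carrier G" "x = d \<otimes> y" "N y \<inter> generate G J = {}"
    using parabolic_decomposition J x by blast
  then have "N d \<subseteq> N x" using N_parabolic_mult[OF J] by blast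
  then have "d = \<one>" using exists_descent[OF J dy(1)] assms(3) by blast
  then show ?thesis using dy by simp
qed

end

section \<open>Dihedral subgroups and the presentation\<close>

lemma word_step_append: "word_step X Q u v \<Longrightarrow> word_step X Q (p @ u @ q) (p @ v @ q)"
proof (induction rule: word_step.induct)
  case (cancel x u b v)
  then show ?case using word_step.cancel[of x X Q "p @ u" b "v @ q"] by simp
next
  case (relator r u v)
  then show ?case using word_step.relator[of r Q X "p @ u" "v @ q"] by simp
qed

lemma equivclp_mono_map:
  assumes "equivclp r x y" "\<And>x y. r x y \<Longrightarrow> equivclp r' (f x) (f y)"
  shows "equivclp r' (f x) (f y)"
  using assms(1)
proof (induction rule: equivclp_induct)
  case (step y z)
  then show ?case using assms(2) by (meson equivclp_sym equivclp_trans)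
qed simp

lemma word_equiv_append:
  "equivclp (word_step X Q) u v \<Longrightarrow> equivclp (word_step X Q) (p @ u @ q) (p @ v @ q)"
  by (erule equivclp_mono_map[where f = "\<lambda>w. p @ w @ q"]) (blast intro: word_step_append)

lemma word_equiv_Cons:
  "equivclp (word_step X Q) u v \<Longrightarrow> equivclp (word_step X Q) (l # u) (l # v)"
  using word_equiv_append[of X Q u v "[l]" "[]"] by simp

definition positive_word :: "'a list \<Rightarrow> ('a \<times> bool) list" where
  "positive_word ws = map (\<lambda>x. (x, True)) ws"

lemma positive_word_simps [simp]:
  "positive_word [] = []"
  "positive_word (x # ws) = (x, True) # positive_word ws"
  "positive_word (us @ vs) = positive_word us @ positive_word vs"
  by (simp_all add: positive_word_def)

text \<open>Shows the Coxeter relators as alternating words, which split into one side of a braid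
  relation and the reverse of the other side.\<close>

lemma positive_word_alternating_even:
  "positive_word (alternating a b (2 * n)) = concat (replicate n [(a, True), (b, True)])"
  by (induction n) auto

lemma word_value_eq_word_prod:
  assumes "\<And>x. x \<in> fst ` set w \<Longrightarrow> inv\<^bsub>G\<^esub> x = x"
  shows "word_value G w = word_prod G (map fst w)"
  using assms by (induction w) auto

context reflection_cocycle
begin

lemma reduced_R: "reduced ws \<Longrightarrow> set ws \<subseteq> R"
  by (simp add: reduced_def)

lemma reduced_head_descent: "reduced (r # ws) \<Longrightarrow> r \<in> N (word_prod G (r # ws))"
  using R_mult_self_in_N[of r "word_prod G ws"] by (simp add: reduced_Cons reduced_R)

lemma reduced_successively: "reduced ws \<Longrightarrow> successively (\<noteq>) ws"
proof (induction ws)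
  case (Cons r ws)
  show ?case
  proof (cases ws)
    case ws: (Cons q vs)
    then have "r \<noteq> q"
      using Cons.prems reduced_R[of vs] R_mult_self_in_N[of r "word_prod G vs"] by (auto simp: reduced_Cons)
    then show ?thesis using Cons ws by (simp add: reduced_Cons)
  qed simp
qed simp

lemma reduced_word_with_head:
  assumes "J \<subseteq> R" "x \<in> generate G J" "a \<in> J" "a \<in> N x"
  obtains ws where "reduced (a # ws)" "set ws \<subseteq> J" "word_prod G (a # ws) = x"
proof -
  have x: "x \<in> carrier G" and a: "a \<in> R" using assms generate_carrier by auto
  have "a \<otimes> x \<in> generate G J" using generate.eng[OF generate.incl[OF assms(3)] assms(2)] .
  then obtain ws where ws: "reduced ws" "set ws \<subseteq> J" "word_prod G ws = a \<otimes> x"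
    using reduced_word_generate assms(1) by blast
  then have "a \<notin> N (word_prod G ws)" using R_mult_self_in_N a x assms by simp
  then show ?thesis using that[of ws] ws a x by (simp add: reduced_Cons)
qed

text \<open>A reduced word has no equal neighbours, so over two letters it alternates, and the
  descent \<open>a\<close> can be taken as its first letter.\<close>

lemma dihedral_descent:
  assumes "a \<in> R" "b \<in> R" "d \<in> generate G {a, b}" "a \<in> N d"
  shows "d = word_prod G (alternating a b (len d))" "reduced (alternating a b (len d))"
proof -
  obtain ws where ws: "reduced (a # ws)" "set ws \<subseteq> {a, b}" "word_prod G (a # ws) = d"
    using reduced_word_with_head[of "{a, b}" d a] assms by auto
  then have "a # ws = alternating a b (Suc (length ws))"
    using alternatingI[of a ws b] reduced_successively by blast
  moreover have "Suc (length ws) = len d" using ws by (simp add: reduced_def)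
  ultimately show "d = word_prod G (alternating a b (len d))" "reduced (alternating a b (len d))"
    using ws by (metis, metis)
qed

text \<open>Both alternating words of length \<open>len d\<close> represent \<open>d\<close>, so
  \<open>m\<close> divides that length; this already makes the order finite. Length greater than
  \<open>m\<close> would contradict reducedness, by one braid relation.\<close>

lemma dihedral_longest:
  assumes ab: "a \<in> R" "b \<in> R" "a \<noteq> b" and d: "d \<in> generate G {a, b}" "a \<in> N d" "b \<in> N d"
  defines "m \<equiv> ord (a \<otimes> b)"
  shows "0 < m" "len d = m" "d = word_prod G (alternating a b m)"
    "d = word_prod G (alternating b a m)" "reduced (alternating a b m)"
proof -
  let ?k = "len d"
  have d': "d \<in> generate G {b, a}" using d by (simp add: insert_commute)
  have ad: "d = word_prod G (alternating a b ?k)" "reduced (alternating a b ?k)"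
    using dihedral_descent[of a b d] ab d by auto
  have bd: "d = word_prod G (alternating b a ?k)"
    using dihedral_descent[of b a d] ab d d' by auto
  have "finite (N d)" using d ab generate_carrier[of "{a, b}" d] by simp
  then have kpos: "0 < ?k" using d by (auto simp: card_gt_0_iff)
  have dvd: "m dvd ?k" using alternating_eq_iff[OF ab(1,2), of ?k] ad bd by (simp add: m_def)
  show mpos: "0 < m" using dvd kpos by (auto intro: Nat.gr0I)
  have "\<not> m < ?k"
  proof
    assume "m < ?k"
    then have k: "?k = ?k - Suc m + Suc m" by simp
    \<comment> \<open>The last \<open>m + 1\<close> letters start with \<open>x\<close>. Rewriting
      the final \<open>m\<close> of them by the braid relation makes these start with
      \<open>x\<close> too, and the two copies cancel.\<close>
    define x where "x = (if even (?k - Suc m) then a else b)"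
    define y where "y = (if even (?k - Suc m) then b else a)"
    have "alternating a b ?k = alternating a b (?k - Suc m) @ alternating x y (Suc m)"
      using alternating_append[of a b "?k - Suc m" "Suc m"] unfolding k[symmetric] x_def y_def
      by (simp split: if_splits)
    then obtain us where xy: "alternating a b ?k = us @ alternating x y (Suc m)"
      "x \<in> R" "y \<in> R" "ord (y \<otimes> x) = m"
      using ab ord_commute[of a b] by (auto simp: x_def y_def m_def)
    then have red: "reduced (x # alternating y x m)" using ad reduced_drop by auto
    have "word_prod G (alternating y x m) = word_prod G (alternating x y m)"
      using alternating_eq_iff[of y x m] xy by simp
    moreover have "alternating x y m = x # alternating y x (m - 1)" using mpos by (cases m) auto
    ultimately have "word_prod G (x # alternating y x m) = word_prod G (alternating y x (m - 1))"
      using xy alternating_R by simp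
    moreover have "len (word_prod G (alternating y x (m - 1))) \<le> m - 1"
      using len_word_prod_le[of "alternating y x (m - 1)"] alternating_R xy by simp
    moreover have "len (word_prod G (x # alternating y x m)) = Suc m"
      using red unfolding reduced_def by simp
    ultimately have "Suc m \<le> m - 1" by (simp only:)
    then show False by simp
  qed
  moreover have "m \<le> ?k" using dvd kpos dvd_imp_le by blast
  ultimately show km: "?k = m" by simp
  show "d = word_prod G (alternating a b m)" "d = word_prod G (alternating b a m)"
    "reduced (alternating a b m)" using ad bd km by auto
qed

text \<open>Inversions of \<open>x\<close> within the dihedral subgroup are those of its parabolic
  factor, so this factor has both descents and \<open>dihedral_longest\<close> applies.\<close>

lemma two_descents:
  assumes x: "x \<in> carrier G" and ab: "a \<in> R" "b \<in> R" "a \<noteq> b" "a \<in> N x" "b \<in> N x"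
  defines "m \<equiv> ord (a \<otimes> b)"
  obtains y where "y \<in> carrier G" "N y \<inter> generate G {a, b} = {}" "0 < m"
    "x = word_prod G (alternating a b m) \<otimes> y" "x = word_prod G (alternating b a m) \<otimes> y"
    "len x = m + len y" "reduced (alternating a b m)"
proof -
  have J: "{a, b} \<subseteq> R" using ab by simp
  obtain d y where dy: "d \<in> generate G {a, b}" "y \<in> carrier G" "x = d \<otimes> y"
    "N y \<inter> generate G {a, b} = {}"
    using parabolic_decomposition[OF J x] by blast
  note add = N_parabolic_mult[OF J dy(1,2,4)]
  have "a \<in> generate G {a, b}" "b \<in> generate G {a, b}" by (auto intro: generate.incl)
  then have "a \<in> N d" "b \<in> N d" using add(2) ab dy(3) by auto
  note long = dihedral_longest[OF ab(1-3) dy(1) this, folded m_def]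
  show ?thesis using that[OF dy(2,4)] long dy(3) add(1) by simp
qed

section \<open>Word equivalence and Matsumoto's argument\<close>

abbreviation word_equiv :: "'a list \<Rightarrow> 'a list \<Rightarrow> bool" where
  "word_equiv us vs \<equiv>
    equivclp (word_step R (coxeter_relators G R)) (positive_word us) (positive_word vs)"

text \<open>The squares are among the Coxeter relators: for \<open>s = s' = a\<close> the product is
  \<one>, whose order is 1.\<close>

lemma square_equiv:
  assumes "a \<in> R"
  shows "equivclp (word_step R (coxeter_relators G R)) [(a, True), (a, True)] []"
proof -
  have "[(a, True), (a, True)] \<in> coxeter_relators G R"
    unfolding coxeter_relators_def using assms
    by (intro CollectI exI[of _ a]) simp
  then show ?thesis using word_step.relator[of _ _ R "[]" "[]"] by (intro r_into_equivclp) fastforce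
qed

lemma word_equiv_square: "a \<in> R \<Longrightarrow> word_equiv (a # a # ws) ws"
  using word_equiv_append[OF square_equiv, of a "[]" "positive_word ws"] by simp

lemma word_equiv_mult_rev: "set ws \<subseteq> R \<Longrightarrow> word_equiv (rev ws @ ws @ us) us"
proof (induction ws)
  case (Cons a ws)
  have "word_equiv (rev ws @ a # a # ws @ us) (rev ws @ ws @ us)"
    using Cons.prems word_equiv_append[OF word_equiv_square[of a "ws @ us"], of "positive_word (rev ws)" "[]"]
    by simp
  then show ?case using Cons equivclp_trans by fastforce
qed simp

text \<open>Insert the reverse of one alternating word followed by that word itself; the relator
  then removes the first two of the three blocks.\<close>

lemma word_equiv_braid:
  assumes "a \<in> R" "b \<in> R"
  defines "m \<equiv> ord (a \<otimes> b)"
  shows "word_equiv (alternating a b m @ us) (alternating b a m @ us)"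
proof -
  have eq: "alternating a b m @ rev (alternating b a m) = alternating a b (2 * m)"
    by (simp add: rev_alternating mult_2 alternating_append)
  have "positive_word (alternating a b (2 * m)) \<in> coxeter_relators G R"
    unfolding positive_word_alternating_even coxeter_relators_def m_def using assms by blast
  then have "word_equiv (alternating a b (2 * m) @ alternating b a m @ us) (alternating b a m @ us)"
    using word_step.relator[of "positive_word (alternating a b (2 * m))" "coxeter_relators G R" R "[]"]
    by (intro r_into_equivclp) simp
  moreover have "word_equiv (alternating a b m @ rev (alternating b a m) @ alternating b a m @ us)
     (alternating a b m @ us)"
    using word_equiv_append[OF word_equiv_mult_rev[of "alternating b a m" us],
        of "positive_word (alternating a b m)" "[]"] alternating_R assms by simp
  ultimately show ?thesis using eq by (metis append.assoc equivclp_sym equivclp_trans)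
qed

text \<open>Equal first letters are stripped. If the first letters \<open>a\<close>,
  \<open>b\<close> differ, both are descents, so the element also has reduced words starting with
  either alternating word of length \<open>ord (a \<otimes> b)\<close>. Each given word shares its
  first letter with one of these, and the two new words differ by a braid relation.\<close>

lemma matsumoto_reduced_words_equiv:
  assumes "reduced us" "reduced vs" "word_prod G us = word_prod G vs"
  shows "word_equiv us vs"
  using assms
proof (induction "length us" arbitrary: us vs)
  case 0
  then have "length vs = length us" unfolding reduced_def by metis
  then show ?case using 0 by simp
next
  case (Suc n)
  have same_head: "word_equiv (a # us') (a # vs')"
    if "reduced (a # us')" "reduced (a # vs')" "word_prod G (a # us') = word_prod G (a # vs')"
      "length us' = n" for a us' vs'
  proof -
    have "a \<in> R" "reduced us'" "reduced vs'" using that by (auto simp: reduced_Cons)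
    moreover from this have "set us' \<subseteq> R" "set vs' \<subseteq> R" by (simp_all add: reduced_R)
    moreover from this \<open>a \<in> R\<close> have "word_prod G us' = word_prod G vs'" using that by simp
    ultimately show ?thesis using Suc.hyps(1)[of us' vs'] that word_equiv_Cons by simp
  qed
  obtain a us' where us: "us = a # us'" using Suc by (cases us) auto
  have "length vs = length us" using Suc.prems unfolding reduced_def by metis
  then obtain b vs' where vs: "vs = b # vs'" using us by (cases vs) auto
  show ?case
  proof (cases "a = b")
    case True
    then show ?thesis using same_head[of a us' vs'] us vs Suc by simp
  next
    case False
    define x where "x = word_prod G us"
    have x': "x = a \<otimes> word_prod G us'" "x = b \<otimes> word_prod G vs'"
      using us vs Suc.prems by (simp_all add: x_def)
    have R: "a \<in> R" "b \<in> R" "set us' \<subseteq> R" "set vs' \<subseteq> R"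
      using us vs Suc.prems by (auto simp: reduced_def)
    have ax: "a \<in> N x" using reduced_head_descent[of a us'] us Suc.prems(1) by (simp only: x_def)
    have bx: "b \<in> N x" using reduced_head_descent[of b vs'] vs Suc.prems(2,3) x_def by metis
    have xc: "x \<in> carrier G" using x' R by simp
    define m where "m = ord (a \<otimes> b)"
    obtain y where y: "y \<in> carrier G" "0 < m" "x = word_prod G (alternating a b m) \<otimes> y"
      "x = word_prod G (alternating b a m) \<otimes> y" "len x = m + len y"
      using two_descents[OF xc R(1,2) False ax bx] unfolding m_def by blast
    obtain ys where ys: "reduced ys" "word_prod G ys = y" using reduced_word y by blast
    have ysR: "set ys \<subseteq> R" using ys by (simp add: reduced_def)
    obtain m' where m': "m = Suc m'" using y(2) by (cases m) auto
    have red: "reduced (alternating a b m @ ys)" "reduced (alternating b a m @ ys)"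
      and val: "word_prod G (alternating a b m @ ys) = x" "word_prod G (alternating b a m @ ys) = x"
      using R ysR ys alternating_R[of a b m] alternating_R[of b a m] y(3-5)
      by (auto simp: reduced_def word_prod_append set_R_carrier)
    have len: "length (alternating a b m @ ys) = Suc n"
      using red(1) val(1) Suc by (simp add: reduced_def x_def)
    have "word_equiv us (alternating a b m @ ys)"
      using same_head[of a us' "alternating b a m' @ ys"] red(1) val(1) us m' Suc x_def by simp
    moreover have "word_equiv (alternating b a m @ ys) vs"
      using same_head[of b "alternating a b m' @ ys" vs'] red(2) val(2) vs m' Suc.prems len x_def by simp
    moreover have "word_equiv (alternating a b m @ ys) (alternating b a m @ ys)"
      using word_equiv_braid[OF R(1,2)] by (simp add: m_def)
    ultimately show ?thesis by (meson equivclp_trans)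
  qed
qed

text \<open>If the new letter \<open>a\<close> is already a descent, Matsumoto replaces the reduced
  word by one starting with \<open>a\<close>, and the square of \<open>a\<close> cancels.\<close>

lemma word_equiv_reduced:
  assumes "set ws \<subseteq> R"
  shows "\<exists>us. reduced us \<and> word_prod G us = word_prod G ws \<and> word_equiv ws us"
  using assms
proof (induction ws)
  case Nil
  show ?case by (intro exI[of _ "[]"]) simp
next
  case (Cons a ws)
  then obtain us where us: "reduced us" "word_prod G us = word_prod G ws" "word_equiv ws us"
    by auto
  have a: "a \<in> R" using Cons.prems by simp
  have usR: "set us \<subseteq> R" using us by (simp add: reduced_def)
  have equiv: "word_equiv (a # ws) (a # us)" using us word_equiv_Cons by simp
  show ?case
  proof (cases "a \<in> N (word_prod G us)")
    case False
    then show ?thesis using us equiv a by (intro exI[of _ "a # us"]) (simp add: reduced_Cons)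
  next
    case True
    obtain vs where vs: "reduced (a # vs)" "set vs \<subseteq> R" "word_prod G (a # vs) = word_prod G us"
      using reduced_word_with_head[of R "word_prod G us" a] a True usR R_generate by auto
    have "word_equiv (a # us) (a # a # vs)"
      using matsumoto_reduced_words_equiv[of us "a # vs"] us vs word_equiv_Cons by simp
    then have "word_equiv (a # ws) vs"
      using equiv word_equiv_square[OF a, of vs] by (meson equivclp_trans)
    moreover have "word_prod G vs = word_prod G (a # ws)"
      using vs a us by (simp flip: us(2) vs(3))
    ultimately show ?thesis using vs by (intro exI[of _ vs]) (simp add: reduced_Cons)
  qed
qed

lemma word_equiv_unsign:
  assumes "w \<in> lists (R \<times> UNIV)"
  shows "equivclp (word_step R (coxeter_relators G R)) w (positive_word (map fst w))"
  using assms
proof (induction w)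
  case (Cons l w)
  then obtain x b where l: "l = (x, b)" "x \<in> R" by (cases l) auto
  have w: "equivclp (word_step R (coxeter_relators G R)) w (positive_word (map fst w))"
    using Cons by simp
  let ?w = "positive_word (map fst w)"
  have "equivclp (word_step R (coxeter_relators G R)) ((x, b) # ?w) ((x, True) # ?w)"
  proof (cases b)
    case False
    \<comment> \<open>The formal inverse of \<open>x\<close> followed by two letters
      \<open>x\<close> reduces in two ways: by the square relator to the inverse, by free
      cancellation to \<open>x\<close>.\<close>
    have 1: "equivclp (word_step R (coxeter_relators G R)) ((x, False) # (x, True) # (x, True) # ?w) ((x, False) # ?w)"
      using word_equiv_append[OF square_equiv[OF l(2)], of "[(x, False)]" ?w] by simp
    have 2: "equivclp (word_step R (coxeter_relators G R)) ((x, False) # (x, True) # (x, True) # ?w) ((x, True) # ?w)"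
      by (rule r_into_equivclp) (use word_step.cancel[of x R _ "[]" False "(x, True) # ?w"] l in simp)
    show ?thesis using equivclp_trans[OF equivclp_sym[OF 1] 2] False by simp
  qed simp
  from equivclp_trans[OF word_equiv_Cons[OF w, of l, unfolded l(1)] this] show ?case by (simp add: l)
qed simp

lemma word_value_R:
  assumes "w \<in> lists (R \<times> UNIV)"
  shows "word_value G w = word_prod G (map fst w)"
  using assms by (intro word_value_eq_word_prod) (auto simp: in_lists_conv_set)

text \<open>The equivalence closure also walks steps backwards, so being a word over
  \<open>R\<close> must pass in both directions.\<close>

lemma word_step_word_prod:
  assumes "word_step R (coxeter_relators G R) u v"
  shows "(set (map fst u) \<subseteq> R \<longleftrightarrow> set (map fst v) \<subseteq> R) \<and>
    (set (map fst v) \<subseteq> R \<longrightarrow> word_prod G (map fst u) = word_prod G (map fst v))"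
  using assms
proof cases
  case (cancel x p b q)
  moreover have "word_prod G (us @ x # x # vs) = word_prod G (us @ vs)"
    if "set us \<subseteq> R" "set vs \<subseteq> R" for us vs
    using that cancel by (simp add: word_prod_append set_R_carrier)
  ultimately show ?thesis by auto
next
  case (relator r p q)
  then obtain a b where ab: "a \<in> R" "b \<in> R" "r = positive_word (alternating a b (2 * ord (a \<otimes> b)))"
    unfolding coxeter_relators_def positive_word_alternating_even by blast
  have eq: "map fst r = alternating a b (2 * ord (a \<otimes> b))"
    by (simp add: ab positive_word_def comp_def)
  have "word_prod G (map fst r) = \<one>" "set (map fst r) \<subseteq> R"
    unfolding eq using ab alternating_R word_prod_alternating_even[of a b "ord (a \<otimes> b)"] by auto
  moreover have "word_prod G (us @ ts @ vs) = word_prod G (us @ vs)"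
    if "set us \<subseteq> R" "set ts \<subseteq> R" "word_prod G ts = \<one>" "set vs \<subseteq> R" for us ts vs
    using that by (simp add: word_prod_append set_R_carrier)
  ultimately show ?thesis using relator by auto
qed

theorem is_coxeter_system: "coxeter_system G R"
proof -
  have "word_value G w = \<one> \<longleftrightarrow> equivclp (word_step R (coxeter_relators G R)) w []"
    if w: "w \<in> lists (R \<times> UNIV)" for w
  proof
    have wR: "set (map fst w) \<subseteq> R" using w by (auto simp: in_lists_conv_set)
    {
      assume "word_value G w = \<one>"
      \<comment> \<open>This reduced word is empty, because \<open>N \<one>\<close> is.\<close>
      then obtain us where "reduced us" "word_prod G us = \<one>" "word_equiv (map fst w) us"
        using word_equiv_reduced[OF wR] word_value_R[OF w] by auto
      then show "equivclp (word_step R (coxeter_relators G R)) w []"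
        using word_equiv_unsign[OF w] by (auto simp: reduced_def intro: equivclp_trans)
    next
      assume *: "equivclp (word_step R (coxeter_relators G R)) w []"
      have "set (map fst v) \<subseteq> R \<and> word_prod G (map fst w) = word_prod G (map fst v)"
        if "equivclp (word_step R (coxeter_relators G R)) w v" for v
        using that
      proof (induction rule: equivclp_induct)
        case base
        show ?case using wR by simp
      next
        case (step y z)
        then show ?case using word_step_word_prod[of y z] word_step_word_prod[of z y] by auto
      qed
      from this[OF *] show "word_value G w = \<one>" using word_value_R[OF w] by simp
    }
  qed
  moreover have "coxeter_relators G R \<subseteq> lists (R \<times> UNIV)"
    by (auto simp: coxeter_relators_def split: if_splits)
  ultimately show ?thesis
    unfolding coxeter_system_def presents_def
    using R_closed R_generate R_neq_one is_group by simp
qed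

end

section \<open>The reflection cocycle of a Coxeter system\<close>

text \<open>For a word with letters r1, r2, r3, ... this is the parity of the number of times
  \<open>t\<close> occurs among r1, r1 r2 r1, r1 r2 r3 r2 r1, and so on.\<close>

fun inversion_parity :: "('a, 'b) monoid_scheme \<Rightarrow> 'a list \<Rightarrow> 'a \<Rightarrow> bool" where
  "inversion_parity G [] t \<longleftrightarrow> False"
| "inversion_parity G (r # ws) t \<longleftrightarrow>
     (t = r) \<noteq> inversion_parity G ws (r \<otimes>\<^bsub>G\<^esub> t \<otimes>\<^bsub>G\<^esub> r)"

lemma card_less_Suc_shift:
  "card {i. i < Suc n \<and> P i} = (if P 0 then 1 else 0) + card {i. i < n \<and> P (Suc i)}"
proof -
  have "{i. i < Suc n \<and> P i} = {i. i = 0 \<and> P 0} \<union> Suc ` {i. i < n \<and> P (Suc i)}"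
    by (auto simp: image_iff less_Suc_eq_0_disj)
  moreover have "finite {i. i < n \<and> P (Suc i)}" by simp
  ultimately show ?thesis by (auto simp: card_Un_disjoint card_image)
qed

context involution_generated
begin

lemma inversion_parity_append:
  assumes "set us \<subseteq> R" "set vs \<subseteq> R" "t \<in> carrier G"
  shows "inversion_parity G (us @ vs) t \<longleftrightarrow>
    inversion_parity G us t \<noteq> inversion_parity G vs (inv (word_prod G us) \<otimes> t \<otimes> word_prod G us)"
  using assms
proof (induction us arbitrary: t)
  case (Cons r us)
  then have "inversion_parity G (us @ vs) (r \<otimes> t \<otimes> r) \<longleftrightarrow>
      inversion_parity G us (r \<otimes> t \<otimes> r) \<noteq>
      inversion_parity G vs (inv (word_prod G us) \<otimes> (r \<otimes> t \<otimes> r) \<otimes> word_prod G us)"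
    by simp
  moreover have "inv (word_prod G us) \<otimes> (r \<otimes> t \<otimes> r) \<otimes> word_prod G us =
      inv (word_prod G (r # us)) \<otimes> t \<otimes> word_prod G (r # us)"
    using Cons.prems by (simp add: inv_mult_group m_assoc)
  ultimately show ?case by auto
qed simp

lemma inversion_parity_alternating:
  assumes "a \<in> R" "b \<in> R" "t \<in> carrier G"
  shows "inversion_parity G (alternating a b n) t \<longleftrightarrow> odd (card {i. i < n \<and> t = (a \<otimes> b) [^] i \<otimes> a})"
  using assms
proof (induction n arbitrary: a b t)
  case (Suc n)
  have "a \<otimes> t \<otimes> a = (b \<otimes> a) [^] i \<otimes> b \<longleftrightarrow> t = (a \<otimes> b) [^] Suc i \<otimes> a" for i
  proof -
    have "t = (a \<otimes> b) [^] Suc i \<otimes> a \<longleftrightarrow> t = a \<otimes> ((b \<otimes> a) [^] i \<otimes> b) \<otimes> a"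
      using mult_pow_swap[of a b i] Suc.prems by (simp add: m_assoc flip: m_assoc[of a "(b \<otimes> a) [^] i"])
    also have "\<dots> \<longleftrightarrow> a \<otimes> t \<otimes> a = (b \<otimes> a) [^] i \<otimes> b"
    proof
      assume "t = a \<otimes> ((b \<otimes> a) [^] i \<otimes> b) \<otimes> a"
      then show "a \<otimes> t \<otimes> a = (b \<otimes> a) [^] i \<otimes> b" using Suc.prems by (simp add: m_assoc)
    next
      assume "a \<otimes> t \<otimes> a = (b \<otimes> a) [^] i \<otimes> b"
      from this[symmetric] show "t = a \<otimes> ((b \<otimes> a) [^] i \<otimes> b) \<otimes> a" using Suc.prems by (simp add: m_assoc)
    qed
    finally show ?thesis by blast
  qed
  then have "inversion_parity G (alternating b a n) (a \<otimes> t \<otimes> a) \<longleftrightarrow>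
      odd (card {i. i < n \<and> t = (a \<otimes> b) [^] Suc i \<otimes> a})"
    using Suc by simp
  then show ?case
    using card_less_Suc_shift[of n "\<lambda>i. t = (a \<otimes> b) [^] i \<otimes> a"] Suc.prems
    by (auto simp del: nat_pow_Suc)
qed simp

text \<open>The reflections listed for this word are (a b)^i a for i below 2 m. Since (a b)^m is
  trivial, the second half of the list repeats the first.\<close>

lemma inversion_parity_relator:
  assumes "a \<in> R" "b \<in> R" "t \<in> carrier G"
  shows "\<not> inversion_parity G (alternating a b (2 * ord (a \<otimes> b))) t"
proof -
  define m where "m = ord (a \<otimes> b)"
  define P where "P i \<longleftrightarrow> t = (a \<otimes> b) [^] (i::nat) \<otimes> a" for i
  have "(a \<otimes> b) [^] (i + m) = (a \<otimes> b) [^] i" for i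
    using nat_pow_mult[of "a \<otimes> b" i m] assms by (simp add: m_def)
  then have P: "P (i + m) \<longleftrightarrow> P i" for i by (simp add: P_def)
  have "{i. i < 2 * m \<and> P i} = {i. i < m \<and> P i} \<union> (\<lambda>i. i + m) ` {i. i < m \<and> P i}"
  proof (intro equalityI subsetI)
    fix i assume i: "i \<in> {i. i < 2 * m \<and> P i}"
    show "i \<in> {i. i < m \<and> P i} \<union> (\<lambda>i. i + m) ` {i. i < m \<and> P i}"
    proof (cases "i < m")
      case False
      then have "i = (i - m) + m" "i - m < m" using i by auto
      moreover have "P (i - m)" using P[of "i - m"] i \<open>i = (i - m) + m\<close> by simp
      ultimately show ?thesis by blast
    qed (use i in auto)
  qed (auto simp: P)
  moreover have "{i. i < m \<and> P i} \<inter> (\<lambda>i. i + m) ` {i. i < m \<and> P i} = {}" by auto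
  moreover have "card ((\<lambda>i. i + m) ` {i. i < m \<and> P i}) = card {i. i < m \<and> P i}"
    by (simp add: card_image)
  ultimately have "card {i. i < 2 * m \<and> P i} = card {i. i < m \<and> P i} + card {i. i < m \<and> P i}"
    by (simp add: card_Un_disjoint)
  then show ?thesis using inversion_parity_alternating[OF assms, of "2 * m"] by (simp add: m_def P_def)
qed

end

locale coxeter = group G for G (structure) +
  fixes S :: "'a set"
  assumes coxeter: "coxeter_system G S"
begin

sublocale involution_generated G S
  using coxeter by unfold_locales (auto simp: coxeter_system_def presents_def)

text \<open>Both kinds of \<open>word_step\<close> delete a block with trivial product in which
  every element occurs an even number of times, and deleting such a block changes no parity.\<close>

lemma inversion_parity_equiv:
  assumes "equivclp (word_step S (coxeter_relators G S)) u v"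
    and "set (map fst u) \<subseteq> S" "t \<in> carrier G"
  shows "set (map fst v) \<subseteq> S \<and> (inversion_parity G (map fst v) t \<longleftrightarrow> inversion_parity G (map fst u) t)"
proof -
  have insert: "inversion_parity G (us @ ts @ vs) t \<longleftrightarrow> inversion_parity G (us @ vs) t"
    if "set us \<subseteq> S" "set ts \<subseteq> S" "set vs \<subseteq> S" "word_prod G ts = \<one>"
      "\<And>t. t \<in> carrier G \<Longrightarrow> \<not> inversion_parity G ts t" for us ts vs
  proof -
    let ?t = "inv (word_prod G us) \<otimes> t \<otimes> word_prod G us"
    have "?t \<in> carrier G" using that assms by simp
    then show ?thesis using that assms(3) by (simp add: inversion_parity_append)
  qed
  have preserve: "(set (map fst u) \<subseteq> S \<longleftrightarrow> set (map fst v) \<subseteq> S) \<and>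
    (set (map fst v) \<subseteq> S \<longrightarrow> (inversion_parity G (map fst u) t \<longleftrightarrow> inversion_parity G (map fst v) t))"
    if "word_step S (coxeter_relators G S) u v" for u v
    using that
  proof cases
    case (cancel x p b q)
    have "t = x \<longleftrightarrow> x \<otimes> t \<otimes> x = x" if "t \<in> carrier G" for t
    proof (rule iffI)
      assume "x \<otimes> t \<otimes> x = x"
      then have "x \<otimes> (x \<otimes> t \<otimes> x) \<otimes> x = x" using cancel by simp
      then show "t = x" using cancel that by (simp add: m_assoc)
    qed (use cancel in simp)
    then have "\<not> inversion_parity G [x, x] t" if "t \<in> carrier G" for t
      unfolding inversion_parity.simps using that by blast
    then show ?thesis using cancel insert[of "map fst p" "[x, x]" "map fst q"]
      by (auto simp del: inversion_parity.simps)
  next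
    case (relator r p q)
    then obtain a b where ab: "a \<in> S" "b \<in> S" "r = positive_word (alternating a b (2 * ord (a \<otimes> b)))"
      unfolding coxeter_relators_def positive_word_alternating_even by blast
    have eq: "map fst r = alternating a b (2 * ord (a \<otimes> b))"
      by (simp add: ab positive_word_def comp_def)
    have "word_prod G (map fst r) = \<one>" "set (map fst r) \<subseteq> S"
      "\<And>t. t \<in> carrier G \<Longrightarrow> \<not> inversion_parity G (map fst r) t"
      unfolding eq using ab alternating_R word_prod_alternating_even[of a b "ord (a \<otimes> b)"]
        inversion_parity_relator by auto
    then show ?thesis using insert[of "map fst p" "map fst r" "map fst q"] relator by auto
  qed
  show ?thesis
    using assms(1)
  proof (induction rule: equivclp_induct)
    case base
    show ?case using assms(2) by simp
  next
    case (step y z)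
    then show ?case using preserve[of y z] preserve[of z y] by auto
  qed
qed

lemma inversion_parity_trivial:
  assumes "set ws \<subseteq> S" "word_prod G ws = \<one>" "t \<in> carrier G"
  shows "\<not> inversion_parity G ws t"
proof -
  let ?w = "positive_word ws"
  have w: "?w \<in> lists (S \<times> UNIV)" "map fst ?w = ws"
    using assms(1) by (auto simp: positive_word_def comp_def)
  have "word_value G ?w = \<one>"
    by (subst word_value_eq_word_prod) (use assms w in \<open>auto simp: positive_word_def\<close>)
  then have "equivclp (word_step S (coxeter_relators G S)) ?w []"
    using coxeter w(1) unfolding coxeter_system_def presents_def by blast
  from inversion_parity_equiv[OF this _ assms(3)] show ?thesis using w assms by simp
qed

lemma inversion_parity_eq:
  assumes "set us \<subseteq> S" "set vs \<subseteq> S" "word_prod G us = word_prod G vs" "t \<in> carrier G"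
  shows "inversion_parity G us t \<longleftrightarrow> inversion_parity G vs t"
proof -
  \<comment> \<open>Appending \<open>rev vs\<close> adds a term that depends on \<open>ws\<close>
    only through its product. The cases \<open>us\<close> and \<open>vs\<close> therefore have the
    same extra term, which drops out on comparison.\<close>
  have "\<not> inversion_parity G (ws @ rev vs) t"
    if "set ws \<subseteq> S" "word_prod G ws = word_prod G vs" for ws
    using that assms
    by (intro inversion_parity_trivial) (simp_all add: word_prod_append set_R_carrier word_prod_rev)
  from this[of us] this[of vs]
  have "\<not> inversion_parity G (us @ rev vs) t" "\<not> inversion_parity G (vs @ rev vs) t"
    using assms by simp_all
  then show ?thesis using assms by (simp add: inversion_parity_append)
qed

definition inversions :: "'a \<Rightarrow> 'a set" where
  "inversions x = {t \<in> carrier G. \<exists>ws. set ws \<subseteq> S \<and> word_prod G ws = x \<and> inversion_parity G ws t}"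

lemma inversions_word_prod:
  assumes "set ws \<subseteq> S" "t \<in> carrier G"
  shows "t \<in> inversions (word_prod G ws) \<longleftrightarrow> inversion_parity G ws t"
  using assms inversion_parity_eq unfolding inversions_def by blast

sublocale reflection_cocycle G S inversions
proof
  fix x assume "x \<in> carrier G"
  show "inversions x \<subseteq> carrier G" by (auto simp: inversions_def)
next
  fix r assume r: "r \<in> S"
  then show "inversions r = {r}"
    using inversions_word_prod[of "[r]"] by (auto simp: inversions_def)
next
  fix x y t assume x: "x \<in> carrier G" and y: "y \<in> carrier G" and t: "t \<in> carrier G"
  obtain us where us: "set us \<subseteq> S" "word_prod G us = x" using carrier_word x by blast
  obtain vs where vs: "set vs \<subseteq> S" "word_prod G vs = y" using carrier_word y by blast
  have "t \<in> inversions (word_prod G (us @ vs)) \<longleftrightarrow> inversion_parity G (us @ vs) t"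
    using inversions_word_prod us vs t by simp
  then show "t \<in> inversions (x \<otimes> y) \<longleftrightarrow> (t \<in> inversions x) \<noteq> (inv x \<otimes> t \<otimes> x \<in> inversions y)"
    using inversion_parity_append[OF us(1) vs(1) t] us vs t x
      inversions_word_prod[OF us(1) t] inversions_word_prod[OF vs(1), of "inv x \<otimes> t \<otimes> x"]
    by (simp add: word_prod_append set_R_carrier)
qed

end

section \<open>Transport of simple reflections\<close>

context reflection_cocycle
begin

text \<open>The cocycle rule is applied to \<open>x\<close>, \<open>r\<close> and
  \<open>inv x\<close> in turn; carrying \<open>q\<close> through \<open>x\<close> and
  \<open>r\<close> and back through \<open>x\<close> amounts to conjugation by
  \<open>t\<close>.\<close>

lemma inversion_of_conjugate:
  assumes x: "x \<in> carrier G" and r: "r \<in> R" and q: "q \<in> carrier G"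
  defines "t \<equiv> x \<otimes> r \<otimes> inv x"
  shows "q \<in> N t \<longleftrightarrow> (q \<in> N x) \<noteq> ((q = t) \<noteq> (t \<otimes> q \<otimes> t \<in> N x))"
proof -
  have "t = x \<otimes> (r \<otimes> inv x)" using x r by (simp add: t_def m_assoc)
  then have "q \<in> N t \<longleftrightarrow> (q \<in> N x) \<noteq> (inv x \<otimes> q \<otimes> x \<in> N (r \<otimes> inv x))"
    using N_mult[of x "r \<otimes> inv x" q] x r q by simp
  also have "inv x \<otimes> q \<otimes> x \<in> N (r \<otimes> inv x) \<longleftrightarrow>
      (inv x \<otimes> q \<otimes> x = r) \<noteq> (r \<otimes> (inv x \<otimes> q \<otimes> x) \<otimes> r \<in> N (inv x))"
    using N_R_mult[of r "inv x" "inv x \<otimes> q \<otimes> x"] x r q by simp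
  also have "r \<otimes> (inv x \<otimes> q \<otimes> x) \<otimes> r \<in> N (inv x) \<longleftrightarrow> t \<otimes> q \<otimes> t \<in> N x"
    using N_inv[of x "r \<otimes> (inv x \<otimes> q \<otimes> x) \<otimes> r"] x r q by (simp add: t_def m_assoc)
  also have "inv x \<otimes> q \<otimes> x = r \<longleftrightarrow> q = t"
  proof
    assume "inv x \<otimes> q \<otimes> x = r"
    from this[symmetric] show "q = t" using x q by (simp add: t_def m_assoc)
  next
    assume "q = t"
    then show "inv x \<otimes> q \<otimes> x = r" using x r by (simp add: t_def m_assoc)
  qed
  finally show ?thesis .
qed

lemma reflections_carrier: "t \<in> reflections G R \<Longrightarrow> t \<in> carrier G"
  by (auto simp: reflections_def)

lemma reflection_square: "t \<in> reflections G R \<Longrightarrow> t \<otimes> t = \<one>"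
  by (auto simp: reflections_def m_assoc)

text \<open>As \<open>q\<close> commutes with \<open>t\<close>, the two terms for \<open>N x\<close>
  in \<open>inversion_of_conjugate\<close> coincide and cancel. With \<open>q = t\<close> this makes
  every reflection an inversion of itself; with \<open>q = s\<close> it shows that reflections other
  than \<open>s\<close> commuting with \<open>s\<close> do not invert \<open>s\<close>.\<close>

lemma commuting_inversion:
  assumes t: "t \<in> reflections G R" and q: "q \<in> carrier G" "q \<otimes> t = t \<otimes> q"
  shows "q \<in> N t \<longleftrightarrow> q = t"
proof -
  obtain x r where xr: "x \<in> carrier G" "r \<in> R" "t = x \<otimes> r \<otimes> inv x"
    using t by (auto simp: reflections_def)
  have tc: "t \<in> carrier G" "t \<otimes> t = \<one>" using reflections_carrier reflection_square t by auto
  have "t \<otimes> q \<otimes> t = q \<otimes> (t \<otimes> t)" using q tc by (simp add: m_assoc flip: q(2))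
  also have "\<dots> = q" using q tc by simp
  finally have "q \<in> N t \<longleftrightarrow> (q \<in> N x) \<noteq> ((q = t) \<noteq> (q \<in> N x))"
    using inversion_of_conjugate[OF xr(1,2) q(1)] xr(3) by simp
  then show ?thesis by blast
qed

lemma reflection_in_N: "t \<in> reflections G R \<Longrightarrow> t \<in> N t"
  using commuting_inversion[of t t] reflections_carrier by simp

lemma reflections_conj:
  assumes "t \<in> reflections G R" "x \<in> carrier G"
  shows "x \<otimes> t \<otimes> inv x \<in> reflections G R"
proof -
  obtain y r where "y \<in> carrier G" "r \<in> R" "t = y \<otimes> r \<otimes> inv y"
    using assms by (auto simp: reflections_def)
  then show ?thesis using assms(2) unfolding reflections_def
    by (intro CollectI exI[of _ "x \<otimes> y"] exI[of _ r]) (simp add: inv_mult_group m_assoc)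
qed

lemma R_reflections: "r \<in> R \<Longrightarrow> r \<in> reflections G R"
  unfolding reflections_def by (intro CollectI exI[of _ \<one>] exI[of _ r]) simp

lemma alternating_odd_reflection:
  "a \<in> R \<Longrightarrow> b \<in> R \<Longrightarrow> (a \<otimes> b) [^] (n::nat) \<otimes> a \<in> reflections G R"
proof (induction n arbitrary: a b)
  case 0
  then show ?case by (simp add: R_reflections)
next
  case (Suc n)
  then have "a \<otimes> ((b \<otimes> a) [^] n \<otimes> b) \<otimes> inv a \<in> reflections G R"
    using reflections_conj[OF Suc.IH[of b a], of a] by simp
  moreover have "a \<otimes> ((b \<otimes> a) [^] n \<otimes> b) \<otimes> inv a = (a \<otimes> b) [^] Suc n \<otimes> a"
    using mult_pow_swap[of a b n] Suc.prems by (simp add: m_assoc flip: m_assoc[of a "(b \<otimes> a) [^] n"])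
  ultimately show ?case by simp
qed

lemma N_alternating:
  assumes "a \<in> R" "b \<in> R" "t \<in> N (word_prod G (alternating a b n))"
  shows "\<exists>i<n. t = (a \<otimes> b) [^] i \<otimes> a"
  using assms
proof (induction n arbitrary: a b t)
  case (Suc n)
  have wR: "word_prod G (alternating b a n) \<in> carrier G" using alternating_R Suc.prems by simp
  then have tc: "t \<in> carrier G"
    using N_closed[of "a \<otimes> word_prod G (alternating b a n)"] Suc.prems by auto
  show ?case
  proof (cases "t = a")
    case True
    then show ?thesis using Suc.prems by (intro exI[of _ 0]) simp
  next
    case False
    then have "a \<otimes> t \<otimes> a \<in> N (word_prod G (alternating b a n))"
      using N_R_mult[of a _ t] Suc.prems wR tc by simp
    then obtain i where i: "i < n" "a \<otimes> t \<otimes> a = (b \<otimes> a) [^] i \<otimes> b"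
      using Suc.IH[of b a] Suc.prems by blast
    have "t = a \<otimes> (a \<otimes> t \<otimes> a) \<otimes> a" using tc Suc.prems by (simp add: m_assoc)
    also have "\<dots> = (a \<otimes> b) [^] Suc i \<otimes> a"
      unfolding i(2) using mult_pow_swap[of a b i] Suc.prems
      by (simp add: m_assoc flip: m_assoc[of a "(b \<otimes> a) [^] i"])
    finally show ?thesis using i by blast
  qed
qed simp

text \<open>For simple reflections \<open>a\<close> and \<open>u\<close> this is the longest element of the dihedral group
  they generate, with the final letter removed: it conjugates \<open>a\<close> to \<open>u\<close> or to itself.
  If \<open>u a\<close> has infinite order, \<open>ord\<close> is \<open>0\<close> and the word is empty.\<close>

definition transporter :: "'a \<Rightarrow> 'a \<Rightarrow> 'a" where
  "transporter a u = word_prod G (alternating u a (ord (u \<otimes> a) - 1))"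

lemma transporter_generate: "transporter a u \<in> generate G {a, u}"
  unfolding transporter_def using set_alternating[of u a] by (intro word_prod_in_generate) blast

lemma transporter_carrier: "a \<in> R \<Longrightarrow> u \<in> R \<Longrightarrow> transporter a u \<in> carrier G"
  unfolding transporter_def using alternating_R by simp

text \<open>For order 2 l + 1 the word has length 2 l: this is the factor that an edge contributes
  to a path element.\<close>

lemma transporter_odd:
  assumes "a \<in> R" "u \<in> R" "odd (ord (u \<otimes> a))"
  shows "transporter a u = (u \<otimes> a) [^] (ord (u \<otimes> a) div 2)"
proof -
  have eq: "ord (u \<otimes> a) - 1 = 2 * (ord (u \<otimes> a) div 2)" using assms(3) by presburger
  show ?thesis unfolding transporter_def eq using assms by (intro word_prod_alternating_even) simp_all
qed

text \<open>For order 2 \<lambda> the word has length 2 (\<lambda> - 1) + 1: this is the middle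
  factor of a path reflection.\<close>

lemma transporter_even:
  assumes "a \<in> R" "u \<in> R" "even (ord (u \<otimes> a))" "0 < ord (u \<otimes> a)"
  shows "transporter a u = (u \<otimes> a) [^] (ord (u \<otimes> a) div 2 - 1) \<otimes> u"
proof -
  have eq: "ord (u \<otimes> a) - 1 = Suc (2 * (ord (u \<otimes> a) div 2 - 1))" using assms(3,4) by presburger
  show ?thesis unfolding transporter_def eq using assms by (intro word_prod_alternating_odd) simp_all
qed

text \<open>Prefixing \<open>a\<close> gives a full side of the braid relation. The other side
  starts with \<open>u\<close>, and its last letter, which depends on the parity of the order, is
  what \<open>a\<close> becomes.\<close>

lemma transporter_conj:
  assumes "a \<in> R" "u \<in> R" "0 < ord (u \<otimes> a)"
  shows "a \<otimes> transporter a u = transporter a u \<otimes> (if odd (ord (u \<otimes> a)) then u else a)"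
proof -
  define m where "m = ord (u \<otimes> a)"
  obtain n where n: "m = Suc n" using assms(3) by (cases m) (auto simp: m_def)
  have "a \<otimes> transporter a u = word_prod G (alternating a u m)"
    by (simp add: transporter_def n flip: m_def)
  also have "\<dots> = word_prod G (alternating u a m)"
    using alternating_eq_iff[OF assms(2,1), of m] by (simp add: m_def)
  also have "alternating u a m = alternating u a n @ [if odd m then u else a]"
    using alternating_append[of u a n 1] n by simp
  also have "word_prod G \<dots> = transporter a u \<otimes> (if odd m then u else a)"
    using assms alternating_R[of u a n]
    by (subst word_prod_append) (auto simp: transporter_def set_R_carrier n simp flip: m_def)
  finally show ?thesis by (simp add: m_def)
qed

text \<open>The equation a = (u a)^i u would make (u a)^(i + 1) trivial, with i + 1 below the
  order.\<close>

lemma not_in_N_transporter: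
  assumes "a \<in> R" "u \<in> R" "0 < ord (u \<otimes> a)"
  shows "a \<notin> N (transporter a u)"
proof
  assume "a \<in> N (transporter a u)"
  then obtain i where i: "i < ord (u \<otimes> a) - 1" "a = (u \<otimes> a) [^] i \<otimes> u"
    using N_alternating assms unfolding transporter_def by blast
  have "(u \<otimes> a) [^] Suc i = (u \<otimes> a) [^] i \<otimes> u \<otimes> a" using assms by (simp add: m_assoc)
  also have "\<dots> = \<one>" using assms by (simp flip: i(2))
  finally have "ord (u \<otimes> a) dvd Suc i" using assms pow_eq_id[of "u \<otimes> a" "Suc i"] by simp
  then show False using i(1) dvd_imp_le[of "ord (u \<otimes> a)" "Suc i"] by linarith
qed

definition commuting_reflections :: "'a \<Rightarrow> 'a set" where
  "commuting_reflections a = reflections G R \<inter> centralizer G a - {a}"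

lemma commuting_reflections_iff:
  "t \<in> commuting_reflections a \<longleftrightarrow> t \<in> reflections G R \<and> t \<otimes> a = a \<otimes> t \<and> t \<noteq> a"
  unfolding commuting_reflections_def centralizer_def using reflections_carrier by auto

text \<open>If t = (u a)^i u commutes with \<open>a\<close>, then (u a)^(i + 1) equals its own
  inverse. As i + 1 is positive and below the order m, this forces m = 2 (i + 1), and t is the
  transporter itself.\<close>

lemma N_transporter_commuting:
  assumes a: "a \<in> R" and u: "u \<in> R" and t: "t \<in> N (transporter a u)" "t \<otimes> a = a \<otimes> t"
  shows "even (ord (u \<otimes> a))" "t = transporter a u"
proof -
  define m where "m = ord (u \<otimes> a)"
  obtain i where i: "i < m - 1" "t = (u \<otimes> a) [^] i \<otimes> u"
    using N_alternating[OF u a] t unfolding transporter_def m_def by blast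
  have "(u \<otimes> a) [^] Suc i = t \<otimes> a" using i a u by (simp add: m_assoc)
  also have "\<dots> = a \<otimes> (u \<otimes> a) [^] i \<otimes> u" unfolding t(2) using i a u by (simp add: m_assoc)
  also have "\<dots> = (a \<otimes> u) [^] Suc i" using mult_pow_swap[OF a u] a u by (simp add: m_assoc)
  also have "\<dots> = inv ((u \<otimes> a) [^] Suc i)"
    using nat_pow_inv[of "u \<otimes> a" "Suc i"] a u by (simp add: inv_mult_group del: nat_pow_Suc)
  finally have "(u \<otimes> a) [^] Suc i \<otimes> (u \<otimes> a) [^] Suc i = \<one>"
    using a u r_inv[of "(u \<otimes> a) [^] Suc i"] by (simp only: nat_pow_closed m_closed R_carrier)
  then have "(u \<otimes> a) [^] (Suc i + Suc i) = \<one>"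
    using a u nat_pow_mult[of "u \<otimes> a" "Suc i" "Suc i"] by (simp only: m_closed R_carrier)
  then have "m dvd Suc i + Suc i"
    using pow_eq_id[of "u \<otimes> a" "Suc i + Suc i"] a u unfolding m_def by (simp only: m_closed R_carrier)
  moreover have "0 < Suc i + Suc i" "Suc i + Suc i < 2 * m" using i by auto
  ultimately have "Suc i + Suc i = m" by (auto elim!: dvdE simp: less_2_cases_iff)
  then have "even m" "i = m div 2 - 1" "0 < m" by auto
  then show "even (ord (u \<otimes> a))" "t = transporter a u"
    using i transporter_even[OF a u] by (simp_all add: m_def)
qed

lemma transporter_commuting_reflection:
  assumes "a \<in> R" "u \<in> R" "even (ord (u \<otimes> a))" "0 < ord (u \<otimes> a)"
  shows "transporter a u \<in> commuting_reflections a"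
proof -
  have "transporter a u \<in> reflections G R"
    using alternating_odd_reflection transporter_even assms by simp
  then show ?thesis
    using transporter_conj[of a u] not_in_N_transporter[of a u] reflection_in_N assms
    by (auto simp: commuting_reflections_iff)
qed

lemma commuting_reflections_conj:
  assumes "x \<in> carrier G" "a \<in> carrier G" "b \<in> carrier G" "a \<otimes> x = x \<otimes> b"
    and "t \<in> commuting_reflections a"
  shows "inv x \<otimes> t \<otimes> x \<in> commuting_reflections b"
proof -
  have t: "t \<in> carrier G" "t \<in> reflections G R" "t \<otimes> a = a \<otimes> t" "t \<noteq> a"
    using assms(5) reflections_carrier by (auto simp: commuting_reflections_iff)
  have b: "b = inv x \<otimes> a \<otimes> x" using assms(1-4) by (simp add: m_assoc)
  have "inv x \<otimes> t \<otimes> x \<in> reflections G R"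
    using reflections_conj[OF t(2), of "inv x"] assms(1) by simp
  moreover have "inv x \<otimes> t \<otimes> x \<otimes> b = inv x \<otimes> (t \<otimes> a) \<otimes> x"
    unfolding b using t(1) assms(1,2) by (simp add: m_assoc)
  moreover have "b \<otimes> (inv x \<otimes> t \<otimes> x) = inv x \<otimes> (a \<otimes> t) \<otimes> x"
    unfolding b using t(1) assms(1,2) by (simp add: m_assoc)
  moreover have "inv x \<otimes> t \<otimes> x \<noteq> b"
  proof
    assume "inv x \<otimes> t \<otimes> x = b"
    then have "x \<otimes> (inv x \<otimes> t \<otimes> x) \<otimes> inv x = x \<otimes> (inv x \<otimes> a \<otimes> x) \<otimes> inv x" unfolding b by simp
    then show False using t assms(1,2) by (simp add: m_assoc)
  qed
  ultimately show ?thesis using t by (simp add: commuting_reflections_iff)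
qed

text \<open>The factor \<open>d\<close> need not transport \<open>a\<close> to a generator a priori,
  but the length count below bounds the length of \<open>c\<close> by 1. So passing from
  \<open>d\<close> to \<open>a \<otimes> d = d \<otimes> c\<close> keeps every descent in
  \<open>J\<close> and gains \<open>a\<close>.\<close>

lemma parabolic_factor:
  assumes w: "w \<in> carrier G" and J: "J \<subseteq> R" and a: "a \<in> J" and b: "b \<in> R"
    and aw: "a \<otimes> w = w \<otimes> b" and naw: "a \<notin> N w"
  obtains d y c where "d \<in> generate G J" "y \<in> carrier G" "w = d \<otimes> y" "N y \<inter> generate G J = {}"
    "c \<in> generate G J" "a \<otimes> d = d \<otimes> c" "c \<otimes> y = y \<otimes> b"
    "len (a \<otimes> d) = Suc (len d)" "a \<in> N (a \<otimes> d)" "J \<inter> N w \<subseteq> N (a \<otimes> d)"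
proof -
  interpret J: subgroup "generate G J" G using generate_subgroup J by blast
  have incl: "j \<in> generate G J" if "j \<in> J" for j using that by (rule generate.incl)
  have aR: "a \<in> R" using a J by blast
  obtain d y where dy: "d \<in> generate G J" "y \<in> carrier G" "w = d \<otimes> y" "N y \<inter> generate G J = {}"
    using parabolic_decomposition[OF J w] by blast
  note add = N_parabolic_mult[OF J dy(1,2,4)]
  have dc: "d \<in> carrier G" using dy(1) by simp
  have Nd: "j \<in> N d \<longleftrightarrow> j \<in> N w" if "j \<in> J" for j using add(2) dy(3) incl[OF that] by auto
  have ad: "a \<notin> N d" using Nd a naw by blast
  have zlen: "len (a \<otimes> d) = Suc (len d)" using len_R_mult_up[OF aR dc ad] .
  have az: "a \<in> N (a \<otimes> d)" using R_mult_self_in_N[OF aR dc] ad by simp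
  define c where "c = inv d \<otimes> a \<otimes> d"
  have cJ: "c \<in> generate G J" using incl[OF a] dy(1) by (simp add: c_def)
  have cc: "c \<in> carrier G" using cJ by simp
  have zc: "a \<otimes> d = d \<otimes> c" using dc aR by (simp add: c_def m_assoc)
  have "d \<otimes> (c \<otimes> y) = d \<otimes> (y \<otimes> b)"
  proof -
    have "d \<otimes> (c \<otimes> y) = a \<otimes> d \<otimes> y" using zc dc cc dy(2) by (simp add: m_assoc)
    also have "\<dots> = a \<otimes> w" using dc aR dy by (simp add: m_assoc)
    also have "\<dots> = d \<otimes> (y \<otimes> b)" using aw dc dy b by (simp add: m_assoc)
    finally show ?thesis .
  qed
  then have cy: "c \<otimes> y = y \<otimes> b" using dc cc dy(2) b by simp
  have "len c + len y = len (y \<otimes> b)" using N_parabolic_mult(1)[OF J cJ dy(2,4)] cy by simp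
  also have "\<dots> \<le> len y + 1" using len_mult_le[of y b] dy(2) b by simp
  finally have c1: "len c \<le> 1" by simp
  \<comment> \<open>\<open>j\<close> lowers the length of \<open>d\<close> by one and
    \<open>c\<close> restores at most one, so \<open>j \<otimes> (a \<otimes> d)\<close> is no
    longer than \<open>d\<close>, hence shorter than \<open>a \<otimes> d\<close>.\<close>
  have "j \<in> N (a \<otimes> d)" if j: "j \<in> J \<inter> N w" for j
  proof -
    have jR: "j \<in> R" and jd: "j \<in> N d" using j J Nd by auto
    have "j \<otimes> (a \<otimes> d) = (j \<otimes> d) \<otimes> c" using zc jR dc cc by (simp add: m_assoc)
    then have "len (j \<otimes> (a \<otimes> d)) \<le> len (j \<otimes> d) + 1"
      using len_mult_le[of "j \<otimes> d" c] jR dc cc c1 by simp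
    then have "len (j \<otimes> (a \<otimes> d)) < len (a \<otimes> d)" using len_R_mult_down[OF jR dc jd] zlen by simp
    then show ?thesis using descent_iff[OF jR] aR dc by simp
  qed
  then show ?thesis using that[OF dy cJ zc cy zlen az] by blast
qed

text \<open>By \<open>parabolic_factor\<close>, \<open>a \<otimes> d\<close> has both
  \<open>a\<close> and \<open>u\<close> as descents, so it is the longest dihedral element. Thus
  \<open>d\<close> is one shorter and starts with \<open>u\<close>, which determines it.\<close>

lemma transporter_factor:
  assumes w: "w \<in> carrier G" and a: "a \<in> R" and b: "b \<in> R" and aw: "a \<otimes> w = w \<otimes> b"
    and naw: "a \<notin> N w" and u: "u \<in> R" and uw: "u \<in> N w"
  obtains y where "y \<in> carrier G" "w = transporter a u \<otimes> y" "u \<noteq> a" "0 < ord (u \<otimes> a)"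
    "N (transporter a u) \<subseteq> N w" "len y < len w"
    "(if odd (ord (u \<otimes> a)) then u else a) \<otimes> y = y \<otimes> b"
    "(if odd (ord (u \<otimes> a)) then u else a) \<notin> N y"
proof -
  have J: "{u, a} \<subseteq> R" using a u by simp
  have inJ: "a \<in> generate G {u, a}" "u \<in> generate G {u, a}" by (auto intro: generate.incl)
  have neq: "u \<noteq> a" using naw uw by blast
  obtain d y c where dyc: "d \<in> generate G {u, a}" "y \<in> carrier G" "w = d \<otimes> y"
    "N y \<inter> generate G {u, a} = {}" "c \<in> generate G {u, a}" "a \<otimes> d = d \<otimes> c" "c \<otimes> y = y \<otimes> b"
    "len (a \<otimes> d) = Suc (len d)" "a \<in> N (a \<otimes> d)" "{u, a} \<inter> N w \<subseteq> N (a \<otimes> d)"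
    using parabolic_factor[OF w J _ b aw naw] by blast
  note add = N_parabolic_mult[OF J dyc(1,2,4)]
  have c: "d \<in> carrier G" "c \<in> carrier G" using generate_carrier[OF J] dyc by auto
  have ud: "u \<in> N d" using add(2) uw dyc(3) inJ by auto
  have "a \<otimes> d \<in> generate G {u, a}" using generate.eng[OF inJ(1) dyc(1)] .
  moreover have "u \<in> N (a \<otimes> d)" using dyc(10) uw by blast
  ultimately have long: "0 < ord (u \<otimes> a)" "len (a \<otimes> d) = ord (u \<otimes> a)"
    using dihedral_longest[OF u a neq] dyc(9) by auto
  then have "len d = ord (u \<otimes> a) - 1" using dyc(8) by simp
  then have d: "d = transporter a u"
    using dihedral_descent(1)[OF u a dyc(1) ud] by (simp add: transporter_def)
  define e where "e = (if odd (ord (u \<otimes> a)) then u else a)"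
  have e: "e \<in> R" "e \<in> generate G {u, a}" using a u inJ by (auto simp: e_def)
  have "d \<otimes> c = d \<otimes> e"
    using transporter_conj[OF a u] long(1) dyc(6) d by (simp add: e_def)
  then have "c = e" using c e by simp
  have "len d > 0" using ud c by (auto simp: card_gt_0_iff)
  then have "len y < len w" using add(1) dyc(3) by simp
  moreover have "e \<notin> N y" using e dyc(4) by blast
  moreover have "e \<otimes> y = y \<otimes> b" using dyc(7) \<open>c = e\<close> by simp
  moreover have "N d \<subseteq> N w" using add(2) dyc(3) by blast
  ultimately show ?thesis
    using that[of y] dyc(2,3) neq long(1) d unfolding e_def by simp
qed

end

section \<open>Uniqueness of descents\<close>

context reflection_cocycle
begin

text \<open>Write \<open>z = x \<otimes> y\<close> with \<open>x\<close> the product of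
  \<open>ws\<close>. Since \<open>k\<close> is an inversion of \<open>z\<close> but not of
  \<open>x\<close>, its conjugate \<open>c\<close> is an inversion of \<open>y\<close>, so a further
  letter can be moved from \<open>y\<close> to the left factor without loss of length.\<close>

lemma all_descents_additive:
  assumes J: "J \<subseteq> R" and z: "z \<in> carrier G" "J \<subseteq> N z"
    and ws: "reduced ws" "set ws \<subseteq> J"
  shows "len z = length ws + len (inv (word_prod G ws) \<otimes> z)"
  using ws
proof (induction ws)
  case Nil
  show ?case using z by simp
next
  case (Cons k ws)
  define x where "x = word_prod G ws"
  define y where "y = inv x \<otimes> z"
  have R: "k \<in> R" "reduced ws" "set ws \<subseteq> R" "k \<notin> N x"
    using Cons.prems by (auto simp: reduced_Cons reduced_R x_def)
  have x: "x \<in> carrier G" "len x = length ws" using R by (simp_all add: x_def reduced_def)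
  have y: "y \<in> carrier G" "z = x \<otimes> y" using x z by (simp_all add: y_def)
  have IH: "len z = length ws + len y" using Cons R by (simp add: x_def y_def)
  define c where "c = inv x \<otimes> k \<otimes> x"
  have "k \<in> N z" using Cons.prems z by auto
  then have "c \<in> N y" using N_mult[of x y k] x y R by (simp add: c_def)
  then have 1: "len (c \<otimes> y) < len y" using N_mult_self_less y by simp
  have kx: "len (k \<otimes> x) = Suc (length ws)" using len_R_mult_up R x by simp
  have "z = (k \<otimes> x) \<otimes> (c \<otimes> y)" using x y R by (simp add: c_def m_assoc)
  then have "len z \<le> Suc (length ws) + len (c \<otimes> y)"
    using len_mult_le[of "k \<otimes> x" "c \<otimes> y"] x y R kx by (simp add: c_def)
  moreover have "inv (word_prod G (k # ws)) \<otimes> z = c \<otimes> y"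
    using x y R by (simp add: c_def inv_mult_group m_assoc flip: x_def)
  ultimately show ?case using 1 IH by simp
qed

text \<open>The parabolic subgroup has bounded length, although \<open>z\<close> may lie outside it.
  A reflection \<open>t\<close> in it splits off from \<open>z\<close> additively, so
  \<open>t \<otimes> z\<close> is shorter, and that makes \<open>t\<close> an inversion of
  \<open>z\<close>.\<close>

lemma all_descents_longest:
  assumes J: "J \<subseteq> R" and z: "z \<in> carrier G" "J \<subseteq> N z"
  shows "d \<in> generate G J \<Longrightarrow> len d \<le> len z"
    and "t \<in> generate G J \<Longrightarrow> t \<in> reflections G R \<Longrightarrow> t \<in> N z"
proof -
  have add: "len z = len d + len (inv d \<otimes> z)" if "d \<in> generate G J" for d
  proof -
    obtain ws where ws: "reduced ws" "set ws \<subseteq> J" "word_prod G ws = d"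
      using reduced_word_generate J \<open>d \<in> generate G J\<close> by blast
    then have "length ws = len d" by (simp add: reduced_def)
    then show ?thesis using all_descents_additive[OF J z ws(1,2)] ws(3) by simp
  qed
  show "len d \<le> len z" if "d \<in> generate G J" using add[OF that] by simp
  assume t: "t \<in> generate G J" "t \<in> reflections G R"
  have tc: "t \<in> carrier G" "t \<otimes> t = \<one>" using reflections_carrier reflection_square t by auto
  have it: "inv t = t" using tc inv_equality by simp
  have "0 < len t" using reflection_in_N[OF t(2)] tc by (auto simp: card_gt_0_iff)
  then have less: "len (t \<otimes> z) < len z" using add[OF t(1)] it by simp
  show "t \<in> N z"
  proof (rule ccontr)
    assume "t \<notin> N z"
    then have "t \<in> N (t \<otimes> z)" using N_mult[of t z t] reflection_in_N[OF t(2)] tc z by simp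
    then have "len (t \<otimes> (t \<otimes> z)) < len (t \<otimes> z)" using N_mult_self_less tc z by simp
    moreover have "t \<otimes> (t \<otimes> z) = z" using inv_mult_cancel(1)[of t z] it tc z by simp
    ultimately show False using less by simp
  qed
qed

text \<open>No braid relation applies to a word in which any three consecutive letters are distinct if
  all labels are at least 3.\<close>

lemma generic_word_len:
  fixes f :: "nat \<Rightarrow> 'a"
  assumes J: "J \<subseteq> R" and f: "\<And>i. f i \<in> J" "\<And>i. f i \<noteq> f (Suc i)" "\<And>i. f i \<noteq> f (Suc (Suc i))"
    and m: "\<And>a b. a \<in> J \<Longrightarrow> b \<in> J \<Longrightarrow> a \<noteq> b \<Longrightarrow> odd (ord (a \<otimes> b))"
  defines "x \<equiv> \<lambda>n. word_prod G (rev (map f [0..<n]))"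
  shows "len (x n) = n"
proof -
  have fR: "f i \<in> R" for i using f(1) J by blast
  have xc: "x n \<in> carrier G" for n using fR by (auto simp: x_def intro!: word_prod_R)
  have xS: "x (Suc n) = f n \<otimes> x n" for n by (simp add: x_def)
  \<comment> \<open>The induction carries the stronger claim that the only possible descent of
    \<open>x n\<close> in \<open>J\<close> is the letter put in front last.\<close>
  have "(\<forall>k\<in>J. k \<in> N (x n) \<longrightarrow> 0 < n \<and> k = f (n - 1)) \<and> len (x n) = n" for n
  proof (induction n rule: less_induct)
    case (less n)
    show ?case
    proof (cases n)
      case 0
      then show ?thesis by (simp add: x_def)
    next
      case (Suc n1)
      define c where "c = f n1"
      have cR: "c \<in> R" "c \<in> J" using fR f by (simp_all add: c_def)
      have IH: "k \<in> J \<Longrightarrow> k \<in> N (x n1) \<Longrightarrow> 0 < n1 \<and> k = f (n1 - 1)" "len (x n1) = n1" for k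
        using less[of n1] Suc by auto
      have nc: "c \<notin> N (x n1)"
      proof
        assume "c \<in> N (x n1)"
        then have "0 < n1" "f n1 = f (n1 - 1)" using IH(1)[of c] cR by (auto simp: c_def)
        then show False using f(2)[of "n1 - 1"] by simp
      qed
      have xn: "x n = c \<otimes> x n1" by (simp add: Suc xS c_def)
      have cx: "c \<in> N (x n)" using R_mult_self_in_N[OF cR(1) xc] nc xn by simp
      have "k = c" if k: "k \<in> J" "k \<in> N (x n)" for k
      proof (rule ccontr)
        assume "k \<noteq> c"
        have kR: "k \<in> R" using k J by blast
        \<comment> \<open>With a second descent \<open>k\<close>, a dihedral longest element splits
          off on the left. Its length \<open>m\<close> is odd and not 1, hence at least 3, so after
          removal of \<open>c\<close> the descent is \<open>k\<close>, and after removal of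
          \<open>k\<close> it is \<open>c\<close> again: the sequence \<open>f\<close> would repeat
          a letter two places apart.\<close>
        define m where "m = ord (c \<otimes> k)"
        obtain y where y: "y \<in> carrier G" "N y \<inter> generate G {c, k} = {}"
          "x n = word_prod G (alternating c k m) \<otimes> y" "reduced (alternating c k m)" "0 < m"
          using two_descents[OF xc cR(1) kR _ cx k(2)] \<open>k \<noteq> c\<close> unfolding m_def by metis
        have "m \<noteq> 1"
        proof
          assume "m = 1"
          then have "c \<otimes> k = \<one>" using ord_eq_1[of "c \<otimes> k"] cR kR by (simp add: m_def)
          then have "c \<otimes> (c \<otimes> k) = c \<otimes> \<one>" by simp
          then show False using cR kR \<open>k \<noteq> c\<close> by simp
        qed
        moreover have "odd m" using assms(5) cR k \<open>k \<noteq> c\<close> by (auto simp: m_def)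
        ultimately obtain m' where m': "m = Suc (Suc (Suc m'))"
          by (metis One_nat_def Suc_diff_1 even_Suc_Suc_iff even_zero not_gr0 y(5))
        have CK: "{c, k} \<subseteq> R" using cR kR by simp
        have altR: "set (alternating c k i) \<subseteq> R" "set (alternating k c i) \<subseteq> R" for i
          using alternating_R cR kR by auto
        have sub: "a \<in> N (word_prod G ws \<otimes> y)" if "reduced (a # vs)" "a # vs = ws" "set ws \<subseteq> {c, k}"
          for a vs ws
          using N_parabolic_mult(2)[OF CK word_prod_in_generate[OF that(3)] y(1,2)]
            reduced_head_descent[OF that(1)] that(2) by blast
        have "x n1 = c \<otimes> x n" using xn cR xc by simp
        define e where "e = word_prod G (alternating k c (Suc (Suc m')))"
        have ec: "e \<in> carrier G" unfolding e_def using altR by (intro word_prod_R)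
        have "x n = c \<otimes> e \<otimes> y" using y(3) by (simp add: m' e_def)
        then have "x n1 = e \<otimes> y" using \<open>x n1 = c \<otimes> x n\<close> ec cR y(1) by (simp add: m_assoc)
        then have x1: "x n1 = word_prod G (alternating k c (Suc (Suc m'))) \<otimes> y" by (simp only: e_def)
        have "k \<in> N (x n1)" unfolding x1
          by (rule sub[of k "alternating c k (Suc m')"])
            (use y(4) set_alternating[of k c "Suc (Suc m')"] in \<open>auto simp: m' reduced_Cons\<close>)
        then have k': "0 < n1" "k = f (n1 - 1)" using IH(1) k by auto
        then obtain n2 where n2: "n1 = Suc n2" by (cases n1) auto
        have "x n2 = k \<otimes> x n1" using k' n2 xS xc kR by simp
        moreover define g where "g = word_prod G (alternating c k (Suc m'))"
        moreover have gc: "g \<in> carrier G" unfolding g_def using altR by (intro word_prod_R)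
        moreover have "x n1 = k \<otimes> g \<otimes> y" using x1 by (simp add: g_def)
        ultimately have "x n2 = g \<otimes> y" using kR y(1) by (simp add: m_assoc)
        then have x2: "x n2 = word_prod G (alternating c k (Suc m')) \<otimes> y" by (simp only: g_def)
        have "c \<in> N (x n2)" unfolding x2
          by (rule sub[of c "alternating k c m'"])
            (use y(4) set_alternating[of c k "Suc m'"] in \<open>auto simp: m' reduced_Cons\<close>)
        then have "0 < n2 \<and> c = f (n2 - 1)" using less[of n2] cR Suc n2 by auto
        then show False using f(3)[of "n2 - 1"] n2 by (simp add: c_def)
      qed
      then show ?thesis using len_R_mult_up[OF cR(1) xc nc] IH(2) xn Suc by (auto simp: c_def)
    qed
  qed
  then show ?thesis by blast
qed

text \<open>The key point for the freeness of the path elements: a second descent \<open>v\<close> next to \<open>u\<close>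
  would make the parabolic subgroup of \<open>a, u, v\<close> finite, with a longest element that inverts
  every reflection except \<open>a\<close>. Such a group contains a reflection commuting with \<open>a\<close>, since
  a triangle group whose three labels are all odd is infinite.\<close>

lemma unique_descent:
  assumes w: "w \<in> carrier G" and a: "a \<in> R" and b: "b \<in> R" and aw: "a \<otimes> w = w \<otimes> b"
    and naw: "a \<notin> N w" and comm: "N w \<inter> commuting_reflections a = {}"
    and u: "u \<in> R" "u \<in> N w" and v: "v \<in> R" "v \<in> N w"
  shows "u = v"
proof (rule ccontr)
  assume uv: "u \<noteq> v"
  \<comment> \<open>For even order the transporter would itself be an inversion of \<open>w\<close>
    commuting with \<open>a\<close>.\<close>
  have odd_a: "k \<noteq> a" "odd (ord (k \<otimes> a))" if k: "k \<in> R" "k \<in> N w" for k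
  proof -
    obtain y where y: "k \<noteq> a" "0 < ord (k \<otimes> a)" "N (transporter a k) \<subseteq> N w"
      using transporter_factor[OF w a b aw naw k] by metis
    show "k \<noteq> a" by fact
    show "odd (ord (k \<otimes> a))"
    proof
      assume "even (ord (k \<otimes> a))"
      then have c: "transporter a k \<in> commuting_reflections a"
        using transporter_commuting_reflection a k y by blast
      then have "transporter a k \<in> N (transporter a k)"
        using reflection_in_N by (simp add: commuting_reflections_iff)
      then show False using c y comm by blast
    qed
  qed
  let ?K = "{a, u, v}"
  have K: "?K \<subseteq> R" using a u v by simp
  obtain d y where dy: "d \<in> generate G ?K" "y \<in> carrier G" "w = d \<otimes> y" "N y \<inter> generate G ?K = {}"
    "a \<in> N (a \<otimes> d)" "?K \<inter> N w \<subseteq> N (a \<otimes> d)"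
    using parabolic_factor[OF w K _ b aw naw] by blast
  have dc: "d \<in> carrier G" using generate_carrier[OF K] dy by blast
  define z where "z = a \<otimes> d"
  have zc: "z \<in> carrier G" using dc a by (simp add: z_def)
  have Kz: "?K \<subseteq> N z" using dy(5,6) u v by (auto simp: z_def)
  \<comment> \<open>Every reflection in this parabolic subgroup is an inversion of
    \<open>z = a \<otimes> d\<close>. One that commutes with \<open>a\<close> and differs from it is
    unaffected by removing \<open>a\<close>, so it is an inversion of \<open>d\<close>, hence of
    \<open>w\<close>.\<close>
  have no_comm: False if t: "t \<in> commuting_reflections a" "t \<in> generate G ?K" for t
  proof -
    have tr: "t \<in> reflections G R" "t \<otimes> a = a \<otimes> t" "t \<noteq> a" "t \<in> carrier G"
      using t reflections_carrier by (auto simp: commuting_reflections_iff)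
    have "t \<in> N z" using all_descents_longest(2)[OF K zc Kz t(2) tr(1)] .
    moreover have "a \<otimes> t \<otimes> a = t" using tr a by (simp add: m_assoc)
    ultimately have "t \<in> N d" using N_R_mult[OF a dc tr(4)] tr by (simp add: z_def)
    then have "t \<in> N w" using N_parabolic_mult(2)[OF K dy(1,2,4)] dy(3) by blast
    then show False using t comm by blast
  qed
  have ord_uv: "0 < ord (v \<otimes> u)"
    using two_descents[OF w v(1) u(1) _ v(2) u(2)] uv by metis
  show False
  proof (cases "even (ord (v \<otimes> u))")
    case True
    \<comment> \<open>The transporter of \<open>v\<close> and \<open>u\<close> commutes with
      \<open>v\<close>, and \<open>x\<close> carries \<open>v\<close> back to \<open>a\<close>; the
      conjugate is the forbidden reflection.\<close>
    define x where "x = transporter a v"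
    have mono: "transporter p q \<in> generate G ?K" if "{p, q} \<subseteq> ?K" for p q
      using transporter_generate[of p q] mono_generate[OF that] by blast
    have x: "x \<in> generate G ?K" "x \<in> carrier G"
      using mono[of a v] transporter_carrier a v by (auto simp: x_def)
    have "a \<otimes> x = x \<otimes> v"
      using transporter_conj[OF a v(1)] odd_a(2)[OF v] by (simp add: x_def odd_pos)
    then have "inv x \<otimes> (a \<otimes> x) \<otimes> inv x = inv x \<otimes> (x \<otimes> v) \<otimes> inv x" by simp
    then have vx: "v \<otimes> inv x = inv x \<otimes> a" using x a v by (simp add: m_assoc)
    have "transporter v u \<in> commuting_reflections v"
      using transporter_commuting_reflection[of v u] ord_uv True u v ord_commute[of v u] by simp
    from commuting_reflections_conj[OF _ _ _ vx this]
    have "x \<otimes> transporter v u \<otimes> inv x \<in> commuting_reflections a" using x a v by simp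
    moreover have "x \<otimes> transporter v u \<otimes> inv x \<in> generate G ?K"
      using x(1) mono[of v u] generate_subgroup[OF K]
      by (simp add: subgroup.m_closed subgroup.m_inv_closed)
    ultimately show False using no_comm by blast
  next
    case False
    \<comment> \<open>All three labels are odd, so the periodic words in \<open>a\<close>,
      \<open>u\<close>, \<open>v\<close> are reduced of every length. One letter more than
      \<open>len z\<close> contradicts the bound from \<open>all_descents_longest\<close>.\<close>
    define f :: "nat \<Rightarrow> 'a" where "f i = (if i mod 3 = 0 then a else if i mod 3 = 1 then u else v)" for i
    have neq: "u \<noteq> a" "v \<noteq> a" using odd_a u v by auto
    have m3: "i mod 3 = 0 \<or> i mod 3 = 1 \<or> i mod 3 = 2" for i :: nat by presburger
    have f: "f i \<in> ?K" "f i \<noteq> f (Suc i)" "f i \<noteq> f (Suc (Suc i))" for i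
      using m3[of i] neq uv by (auto simp: f_def mod_Suc)
    have odd: "odd (ord (p \<otimes> q))" if "p \<in> ?K" "q \<in> ?K" "p \<noteq> q" for p q
      using that odd_a(2)[OF u] odd_a(2)[OF v] False ord_commute[of a u] ord_commute[of a v]
        ord_commute[of v u] a u v by auto
    let ?ws = "rev (map f [0..<Suc (len z)])"
    have "len (word_prod G ?ws) = Suc (len z)"
      using generic_word_len[of ?K f "Suc (len z)"] K f odd by blast
    moreover have "set ?ws \<subseteq> ?K" using f(1) by auto
    then have "len (word_prod G ?ws) \<le> len z"
      using all_descents_longest(1)[OF K zc Kz] word_prod_in_generate by blast
    ultimately show False by simp
  qed
qed

end

section \<open>Path elements\<close>

lemma edge_path_simps [simp]:
  "edge_path V E [a] \<longleftrightarrow> a \<in> V"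
  "edge_path V E (a # b # \<gamma>) \<longleftrightarrow> a \<in> V \<and> E a b \<and> edge_path V E (b # \<gamma>)"
  by (auto simp: edge_path_def)

lemma edge_path_snoc:
  "edge_path V E \<gamma> \<Longrightarrow> E (last \<gamma>) b \<Longrightarrow> b \<in> V \<Longrightarrow> edge_path V E (\<gamma> @ [b])"
  by (auto simp: edge_path_def successively_append_iff)

lemma edge_path_rev:
  assumes "symp E" "edge_path V E \<gamma>"
  shows "edge_path V E (rev \<gamma>)"
  using assms by (auto simp: edge_path_def successively_rev elim: successively_mono dest: sympD)

lemma edge_path_append:
  assumes "edge_path V E \<gamma>" "edge_path V E \<delta>" "last \<gamma> = hd \<delta>"
  shows "edge_path V E (\<gamma> @ tl \<delta>)" "last (\<gamma> @ tl \<delta>) = last \<delta>"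
  using assms by (cases \<delta>; cases "tl \<delta>"; auto simp: edge_path_def successively_append_iff)+

lemma edge_loops_append:
  "\<gamma> \<in> edge_loops V E v \<Longrightarrow> \<delta> \<in> edge_loops V E v \<Longrightarrow> \<gamma> @ tl \<delta> \<in> edge_loops V E v"
  using edge_path_append[of V E \<gamma> \<delta>] by (auto simp: edge_loops_def edge_path_def)

lemma edge_loops_rev: "symp E \<Longrightarrow> \<gamma> \<in> edge_loops V E v \<Longrightarrow> rev \<gamma> \<in> edge_loops V E v"
  using edge_path_rev[of E V \<gamma>] by (auto simp: edge_loops_def hd_rev last_rev)

lemma edge_path_backtrack:
  assumes "E a b" "E b a" "b \<in> V"
  shows "edge_path V E (xs @ [a, b, a] @ ys) \<longleftrightarrow> edge_path V E (xs @ [a] @ ys)"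
  using assms by (auto simp: edge_path_def successively_append_iff successively_Cons)

lemma backtrack_step_hd_last:
  assumes "backtrack_step E \<gamma> \<delta>"
  shows "hd \<gamma> = hd \<delta>" "last \<gamma> = last \<delta>"
proof -
  obtain xs a b ys where *: "\<gamma> = xs @ [a, b, a] @ ys" "\<delta> = xs @ [a] @ ys"
    using assms by cases
  show "hd \<gamma> = hd \<delta>" unfolding * by (cases xs) auto
  show "last \<gamma> = last \<delta>" unfolding * by (cases ys rule: rev_cases) auto
qed

section \<open>Removal of backtracks\<close>

fun non_backtracking :: "'a list \<Rightarrow> bool" where
  "non_backtracking (a # b # c # \<gamma>) \<longleftrightarrow> a \<noteq> c \<and> non_backtracking (b # c # \<gamma>)"
| "non_backtracking _ \<longleftrightarrow> True"

lemma not_non_backtrackingD: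
  "\<not> non_backtracking \<gamma> \<Longrightarrow> \<exists>xs a b ys. \<gamma> = xs @ [a, b, a] @ ys"
proof (induction \<gamma> rule: non_backtracking.induct)
  case (1 a b c \<gamma>)
  show ?case
  proof (cases "a = c")
    case True
    then show ?thesis by (metis append_Cons append_Nil)
  next
    case False
    then obtain xs a' b' ys where "b # c # \<gamma> = xs @ [a', b', a'] @ ys" using 1 by auto
    then have "a # b # c # \<gamma> = (a # xs) @ [a', b', a'] @ ys" by simp
    then show ?thesis by blast
  qed
qed auto

lemma non_backtracking_Cons: "non_backtracking (a # \<gamma>) \<Longrightarrow> non_backtracking \<gamma>"
  by (cases "a # \<gamma>" rule: non_backtracking.cases) auto

lemma non_backtracking_representative:
  assumes "symp E" "edge_path V E \<gamma>"
  shows "\<exists>\<delta>. edge_path V E \<delta> \<and> non_backtracking \<delta> \<and> hd \<delta> = hd \<gamma> \<and> last \<delta> = last \<gamma> \<and>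
    equivclp (backtrack_step E) \<gamma> \<delta>"
  using assms(2)
proof (induction "length \<gamma>" arbitrary: \<gamma> rule: less_induct)
  case less
  show ?case
  proof (cases "non_backtracking \<gamma>")
    case True
    then show ?thesis using less.prems by (intro exI[of _ \<gamma>]) simp
  next
    case False
    then obtain xs a b ys where \<gamma>: "\<gamma> = xs @ [a, b, a] @ ys"
      using not_non_backtrackingD by blast
    let ?\<delta> = "xs @ [a] @ ys"
    have ab: "E a b" "b \<in> V"
      using less.prems by (auto simp: \<gamma> edge_path_def successively_append_iff)
    then have "edge_path V E ?\<delta>"
      using edge_path_backtrack[of E a b V xs ys] assms(1) less.prems \<gamma> by (auto dest: sympD)
    then obtain \<delta> where "edge_path V E \<delta>" "non_backtracking \<delta>" "hd \<delta> = hd ?\<delta>" "last \<delta> = last ?\<delta>"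
      "equivclp (backtrack_step E) ?\<delta> \<delta>"
      using less.hyps[of ?\<delta>] \<gamma> by auto
    moreover have step: "backtrack_step E \<gamma> ?\<delta>"
      unfolding \<gamma> using ab by (intro backtrack_step.intros)
    then have "equivclp (backtrack_step E) \<gamma> ?\<delta>" by blast
    ultimately show ?thesis using backtrack_step_hd_last[OF step] by (metis equivclp_trans)
  qed
qed

section \<open>Multiplicativity and homotopy invariance of path elements\<close>

context involution_generated
begin

lemma odd_joined_iff:
  "odd_joined G R t u \<longleftrightarrow> t \<in> R \<and> u \<in> R \<and> t \<noteq> u \<and> odd (ord (t \<otimes> u))"
  by (simp add: odd_joined_def)

lemma odd_joined_sym: "odd_joined G R t u \<Longrightarrow> odd_joined G R u t"
  using ord_commute[of t u] by (auto simp: odd_joined_iff)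

lemma symp_odd_joined: "symp (odd_joined G R)"
  using odd_joined_sym by (auto intro: sympI)

lemma path_elt_closed [simp]: "set \<gamma> \<subseteq> R \<Longrightarrow> path_elt G \<gamma> \<in> carrier G"
proof (induction \<gamma>)
  case (Cons a \<gamma>)
  then show ?case by (cases \<gamma>) auto
qed simp

lemma path_elt_split:
  "set (xs @ a # ys) \<subseteq> R \<Longrightarrow> path_elt G (xs @ a # ys) = path_elt G (xs @ [a]) \<otimes> path_elt G (a # ys)"
proof (induction xs)
  case (Cons x xs)
  show ?case
  proof (cases xs)
    case Nil
    then show ?thesis using Cons.prems by simp
  next
    case (Cons x' xs')
    then show ?thesis using Cons.IH Cons.prems by (simp add: m_assoc)
  qed
qed simp

lemma path_elt_append:
  assumes "set \<gamma> \<subseteq> R" "set \<delta> \<subseteq> R" "\<gamma> \<noteq> []" "\<delta> \<noteq> []" "last \<gamma> = hd \<delta>"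
  shows "path_elt G (\<gamma> @ tl \<delta>) = path_elt G \<gamma> \<otimes> path_elt G \<delta>"
  using path_elt_split[of "butlast \<gamma>" "hd \<delta>" "tl \<delta>"] assms
  by (metis append.assoc append_Cons append_Nil append_butlast_last_id hd_Cons_tl le_sup_iff set_append)

text \<open>The order does not depend on the direction of the edge, so the two traversals contribute
  (b a)^n and (a b)^n, which are inverse to each other.\<close>

lemma path_elt_backtrack:
  assumes "odd_joined G R a b" "set ys \<subseteq> R"
  shows "path_elt G (a # b # a # ys) = path_elt G (a # ys)"
proof -
  have ab: "a \<in> R" "b \<in> R" using assms by (auto simp: odd_joined_iff)
  have "inv ((b \<otimes> a) [^] n) = (a \<otimes> b) [^] n" for n :: nat
    using nat_pow_inv[of "b \<otimes> a" n] ab by (simp add: inv_mult_group)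
  then have "(b \<otimes> a) [^] n \<otimes> ((a \<otimes> b) [^] n \<otimes> x) = x" if "x \<in> carrier G" for n :: nat and x
    using inv_mult_cancel(2)[of "(b \<otimes> a) [^] n" x] that ab by simp
  then show ?thesis using assms ab ord_commute[of a b] by simp
qed

lemma path_elt_backtrack_step:
  assumes "backtrack_step (odd_joined G R) \<gamma> \<delta>" "set \<gamma> \<subseteq> R \<or> set \<delta> \<subseteq> R"
  shows "path_elt G \<gamma> = path_elt G \<delta>" "set \<gamma> \<subseteq> R" "set \<delta> \<subseteq> R"
proof -
  obtain xs a b ys where *: "\<gamma> = xs @ [a, b, a] @ ys" "\<delta> = xs @ [a] @ ys" "odd_joined G R a b"
    using assms(1) by cases
  then have ab: "a \<in> R" "b \<in> R" by (auto simp: odd_joined_iff)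
  show R: "set \<gamma> \<subseteq> R" "set \<delta> \<subseteq> R" using assms(2) * ab by auto
  show "path_elt G \<gamma> = path_elt G \<delta>"
    using path_elt_split[of xs a "b # a # ys"] path_elt_split[of xs a ys] path_elt_backtrack[OF *(3), of ys] R *
    by (simp del: path_elt.simps(1))
qed

lemma path_elt_equiv:
  assumes "equivclp (backtrack_step (odd_joined G R)) \<gamma> \<delta>" "set \<gamma> \<subseteq> R"
  shows "set \<delta> \<subseteq> R \<and> path_elt G \<delta> = path_elt G \<gamma>"
  using assms
proof (induction rule: equivclp_induct)
  case (step y z)
  then show ?case using path_elt_backtrack_step[of y z] path_elt_backtrack_step[of z y] by auto
qed simp

lemma path_elt_rev:
  assumes "edge_path R (odd_joined G R) \<gamma>"
  shows "path_elt G (rev \<gamma>) = inv (path_elt G \<gamma>)"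
  using assms
proof (induction \<gamma>)
  case (Cons a \<gamma>)
  show ?case
  proof (cases \<gamma>)
    case Nil
    then show ?thesis by simp
  next
    case \<gamma>: (Cons b \<delta>)
    then have ab: "a \<in> R" "b \<in> R" "edge_path R (odd_joined G R) \<gamma>" and \<delta>: "set \<delta> \<subseteq> R"
      using Cons.prems by (auto simp: odd_joined_iff edge_path_def)
    have "path_elt G (rev (a # \<gamma>)) = path_elt G (rev \<gamma>) \<otimes> path_elt G [b, a]"
      using path_elt_split[of "rev \<delta>" b "[a]"] ab \<delta> \<gamma> by (simp del: path_elt.simps(1))
    moreover have "path_elt G [b, a] = inv (path_elt G [a, b])"
      using nat_pow_inv[of "b \<otimes> a"] ab ord_commute[of a b] by (simp add: inv_mult_group)
    moreover have "path_elt G (a # \<gamma>) = path_elt G [a, b] \<otimes> path_elt G \<gamma>"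
      using path_elt_split[of "[a]" b \<delta>] ab \<delta> \<gamma> by simp
    ultimately show ?thesis using Cons.IH ab \<delta> \<gamma> by (simp add: inv_mult_group del: path_elt.simps(1))
  qed
qed (simp add: edge_path_def)

end

section \<open>Inversions and descents of path elements\<close>

context reflection_cocycle
begin

lemma path_elt_transporter:
  assumes "odd_joined G R a b"
  shows "path_elt G (a # b # \<gamma>) = transporter a b \<otimes> path_elt G (b # \<gamma>)"
  using assms transporter_odd[of a b] ord_commute[of a b] by (auto simp: odd_joined_iff)

lemma transporter_odd_joined:
  assumes "odd_joined G R a b"
  shows "a \<otimes> transporter a b = transporter a b \<otimes> b" "a \<notin> N (transporter a b)"
    "N (transporter a b) \<inter> commuting_reflections a = {}"
proof -
  have ab: "a \<in> R" "b \<in> R" "odd (ord (b \<otimes> a))" "0 < ord (b \<otimes> a)"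
    using assms odd_joined_sym[of a b] by (auto simp: odd_joined_iff odd_pos)
  show "a \<otimes> transporter a b = transporter a b \<otimes> b" using transporter_conj ab by simp
  show "a \<notin> N (transporter a b)" using not_in_N_transporter ab by simp
  show "N (transporter a b) \<inter> commuting_reflections a = {}"
    using N_transporter_commuting(1)[OF ab(1,2)] ab(3) by (auto simp: commuting_reflections_iff)
qed

text \<open>The transporter of the first edge satisfies all three properties and conjugates the
  reflections commuting with \<open>b\<close> to those commuting with \<open>a\<close>; the cocycle
  rule then combines it with the rest of the path.\<close>

lemma path_elt_facts:
  assumes "edge_path R (odd_joined G R) \<gamma>"
  shows "hd \<gamma> \<otimes> path_elt G \<gamma> = path_elt G \<gamma> \<otimes> last \<gamma>" (is ?A)
    and "hd \<gamma> \<notin> N (path_elt G \<gamma>)" (is ?B)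
    and "N (path_elt G \<gamma>) \<inter> commuting_reflections (hd \<gamma>) = {}" (is ?C)
proof -
  have "?A \<and> ?B \<and> ?C"
    using assms
  proof (induction \<gamma>)
    case (Cons a \<gamma>)
    show ?case
    proof (cases \<gamma>)
      case Nil
      then show ?thesis using Cons.prems by simp
    next
      case \<gamma>: (Cons b \<delta>)
      define x where "x = transporter a b"
      define y where "y = path_elt G \<gamma>"
      have ab: "odd_joined G R a b" "a \<in> R" "b \<in> R" "set \<gamma> \<subseteq> R" "last \<gamma> \<in> R"
        "edge_path R (odd_joined G R) \<gamma>"
        using Cons.prems \<gamma> by (auto simp: odd_joined_iff edge_path_def)
      have c: "x \<in> carrier G" "y \<in> carrier G"
        using ab transporter_carrier by (simp_all add: x_def y_def)
      have IH: "b \<otimes> y = y \<otimes> last \<gamma>" "b \<notin> N y" "N y \<inter> commuting_reflections b = {}"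
        using Cons.IH ab \<gamma> by (simp_all add: y_def)
      note step = transporter_odd_joined[OF ab(1), folded x_def]
      have p: "path_elt G (a # \<gamma>) = x \<otimes> y"
        using path_elt_transporter[OF ab(1)] \<gamma> by (simp add: x_def y_def)
      have "a \<otimes> (x \<otimes> y) = (x \<otimes> b) \<otimes> y" using step(1) ab c by (simp flip: m_assoc)
      also have "\<dots> = x \<otimes> y \<otimes> last \<gamma>" using IH(1) ab c by (simp add: m_assoc)
      finally have A: "a \<otimes> (x \<otimes> y) = x \<otimes> y \<otimes> last \<gamma>" .
      have "inv x \<otimes> a \<otimes> x = b" using step(1) ab c by (simp add: m_assoc)
      then have B: "a \<notin> N (x \<otimes> y)" using N_mult[of x y a] step(2) IH(2) ab c by simp
      have "t \<notin> N (x \<otimes> y)" if t: "t \<in> commuting_reflections a" for t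
      proof -
        have "inv x \<otimes> t \<otimes> x \<in> commuting_reflections b"
          using commuting_reflections_conj[OF c(1) _ _ step(1) t] ab by simp
        moreover have "t \<in> carrier G"
          using t reflections_carrier by (simp add: commuting_reflections_iff)
        ultimately show ?thesis using N_mult[of x y t] c IH(3) step(3) t by blast
      qed
      then show ?thesis using A B p \<gamma> by auto
    qed
  qed (simp add: edge_path_def)
  then show ?A ?B ?C by blast+
qed

text \<open>The rest \<open>y\<close> of the path inverts neither \<open>a\<close> nor
  \<open>b\<close>, so inversions in their dihedral group come from the transporter. That is
  nontrivial without the descent \<open>a\<close>, so it has the descent \<open>b\<close>, and
  \<open>unique_descent\<close> excludes others.\<close>

lemma path_elt_descent_step:
  assumes path: "edge_path R (odd_joined G R) (a # b # \<gamma>)" and k: "k \<in> R"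
    and na: "a \<notin> N (path_elt G (b # \<gamma>))"
  shows "k \<in> N (path_elt G (a # b # \<gamma>)) \<longleftrightarrow> k = b"
proof -
  define x where "x = transporter a b"
  define y where "y = path_elt G (b # \<gamma>)"
  have ab: "odd_joined G R a b" "a \<in> R" "b \<in> R" "a \<noteq> b" "set \<gamma> \<subseteq> R" "last (b # \<gamma>) \<in> R"
    using path by (auto simp: odd_joined_iff edge_path_def)
  have c: "x \<in> carrier G" "y \<in> carrier G"
    using ab transporter_carrier by (simp_all add: x_def y_def del: path_elt.simps)
  have p: "path_elt G (a # b # \<gamma>) = x \<otimes> y"
    using path_elt_transporter[OF ab(1)] by (simp add: x_def y_def)
  note facts = path_elt_facts[OF path, unfolded p list.sel]
  have "b \<notin> N y" using path_elt_facts(2)[of "b # \<gamma>"] path by (simp add: y_def)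
  then have disj: "N y \<inter> generate G {a, b} = {}"
    using N_disjoint_parabolicI[of "{a, b}" y] na ab c by (simp add: y_def)
  have xJ: "x \<in> generate G {a, b}" unfolding x_def by (rule transporter_generate)
  note step = transporter_odd_joined[OF ab(1), folded x_def]
  have "x \<noteq> \<one>" using step(1) ab by auto
  then have "b \<in> N x" using exists_descent[OF _ xJ] step(2) ab by auto
  then have bN: "b \<in> N (x \<otimes> y)" using N_parabolic_mult(2)[OF _ xJ c(2) disj] ab by auto
  show ?thesis
    using unique_descent[OF _ ab(2) _ facts k _ ab(3) bN] bN ab c p by auto
qed

text \<open>Absence of backtracks supplies the hypothesis of \<open>path_elt_descent_step\<close>:
  the only descent of the remaining path element is its second vertex \<open>c\<close>, which
  differs from \<open>a\<close>.\<close>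

lemma path_elt_descent:
  assumes "edge_path R (odd_joined G R) (a # b # \<gamma>)" "non_backtracking (a # b # \<gamma>)" "k \<in> R"
  shows "k \<in> N (path_elt G (a # b # \<gamma>)) \<longleftrightarrow> k = b"
  using assms
proof (induction \<gamma> arbitrary: a b k)
  case Nil
  then show ?case using path_elt_descent_step[of a b "[]" k] by simp
next
  case (Cons c \<gamma>)
  have "a \<in> R" using Cons.prems by simp
  then have "a \<notin> N (path_elt G (b # c # \<gamma>))"
    using Cons.IH[of b c a] Cons.prems by (simp del: path_elt.simps)
  then show ?case using path_elt_descent_step[of a b "c # \<gamma>" k] Cons.prems by blast
qed

lemma non_backtracking_path_eqI:
  assumes "edge_path R (odd_joined G R) \<gamma>" "non_backtracking \<gamma>"
    and "edge_path R (odd_joined G R) \<delta>" "non_backtracking \<delta>"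
    and "hd \<gamma> = hd \<delta>" "path_elt G \<gamma> = path_elt G \<delta>"
  shows "\<gamma> = \<delta>"
  using assms
proof (induction \<gamma> arbitrary: \<delta>)
  case (Cons a \<gamma>)
  obtain \<delta>' where \<delta>: "\<delta> = a # \<delta>'" using Cons.prems by (cases \<delta>) (auto simp: edge_path_def)
  have trivial: "path_elt G (a # b # \<epsilon>) \<noteq> \<one>"
    if "edge_path R (odd_joined G R) (a # b # \<epsilon>)" "non_backtracking (a # b # \<epsilon>)" for b \<epsilon>
    using path_elt_descent[OF that, of b] that by (auto simp: odd_joined_iff simp del: path_elt.simps)
  show ?case
  proof (cases \<gamma>)
    case Nil
    then show ?thesis using trivial Cons.prems \<delta> by (cases \<delta>') (auto simp del: path_elt.simps(1))
  next
    case \<gamma>: (Cons b \<gamma>')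
    show ?thesis
    proof (cases \<delta>')
      case Nil
      then show ?thesis using trivial[of b \<gamma>'] Cons.prems \<delta> \<gamma> by simp
    next
      case \<delta>': (Cons c \<delta>'')
      have bc: "odd_joined G R a b" "odd_joined G R a c" "b \<in> R" "c \<in> R" "a \<in> R"
        "set \<gamma>' \<subseteq> R" "set \<delta>'' \<subseteq> R"
        using Cons.prems \<gamma> \<delta> \<delta>' by (auto simp: odd_joined_iff edge_path_def)
      have "b = c"
        using path_elt_descent[of a b \<gamma>' b] path_elt_descent[of a c \<delta>'' b] Cons.prems \<gamma> \<delta> \<delta>' bc
        by (simp del: path_elt.simps)
      moreover have "transporter a b \<otimes> path_elt G \<gamma> = transporter a c \<otimes> path_elt G \<delta>'"
        using Cons.prems(6) path_elt_transporter[OF bc(1)] path_elt_transporter[OF bc(2)] \<gamma> \<delta> \<delta>' by simp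
      ultimately have "path_elt G \<gamma> = path_elt G \<delta>'"
        using transporter_carrier[of a b] bc \<gamma> \<delta>' by (simp del: path_elt.simps)
      then have "\<gamma> = \<delta>'"
        using Cons.IH[of \<delta>'] Cons.prems non_backtracking_Cons[of a] \<gamma> \<delta> \<delta>' \<open>b = c\<close>
        by (simp del: path_elt.simps non_backtracking.simps)
      then show ?thesis by (simp add: \<delta>)
    qed
  qed
qed (simp add: edge_path_def)

lemma path_elt_eq_iff:
  assumes "edge_path R (odd_joined G R) \<gamma>" "edge_path R (odd_joined G R) \<delta>" "hd \<gamma> = hd \<delta>"
  shows "path_elt G \<gamma> = path_elt G \<delta> \<longleftrightarrow> equivclp (backtrack_step (odd_joined G R)) \<gamma> \<delta>"
proof
  assume eq: "path_elt G \<gamma> = path_elt G \<delta>"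
  obtain \<gamma>' where \<gamma>': "edge_path R (odd_joined G R) \<gamma>'" "non_backtracking \<gamma>'" "hd \<gamma>' = hd \<gamma>"
    "equivclp (backtrack_step (odd_joined G R)) \<gamma> \<gamma>'"
    using non_backtracking_representative[OF symp_odd_joined assms(1)] by blast
  obtain \<delta>' where \<delta>': "edge_path R (odd_joined G R) \<delta>'" "non_backtracking \<delta>'" "hd \<delta>' = hd \<delta>"
    "equivclp (backtrack_step (odd_joined G R)) \<delta> \<delta>'"
    using non_backtracking_representative[OF symp_odd_joined assms(2)] by blast
  have "path_elt G \<gamma>' = path_elt G \<delta>'"
    using path_elt_equiv[OF \<gamma>'(4)] path_elt_equiv[OF \<delta>'(4)] eq assms by (simp add: edge_path_def)
  then have "\<gamma>' = \<delta>'" using non_backtracking_path_eqI \<gamma>' \<delta>' assms(3) by simp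
  then show "equivclp (backtrack_step (odd_joined G R)) \<gamma> \<delta>"
    using \<gamma>'(4) \<delta>'(4) by (metis equivclp_sym equivclp_trans)
next
  assume "equivclp (backtrack_step (odd_joined G R)) \<gamma> \<delta>"
  then show "path_elt G \<gamma> = path_elt G \<delta>"
    using path_elt_equiv assms(1) by (simp add: edge_path_def)
qed

end

section \<open>The centralizer of a generator\<close>

context reflection_cocycle
begin

text \<open>In terms of roots, these are the elements that fix the positive root of \<open>s\<close>
  rather than negating it. This is the complement of the subgroup generated by
  \<open>s\<close>.\<close>

definition positive_centralizer :: "'a \<Rightarrow> 'a set" where
  "positive_centralizer s = {w \<in> centralizer G s. s \<notin> N w}"

lemma centralizer_iff: "x \<in> centralizer G s \<longleftrightarrow> x \<in> carrier G \<and> x \<otimes> s = s \<otimes> x"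
  by (simp add: centralizer_def)

lemma positive_centralizer_iff:
  "w \<in> positive_centralizer s \<longleftrightarrow> w \<in> carrier G \<and> w \<otimes> s = s \<otimes> w \<and> s \<notin> N w"
  by (simp add: positive_centralizer_def centralizer_iff)

lemma centralizer_subgroup:
  assumes "s \<in> carrier G"
  shows "subgroup (centralizer G s) G"
proof (rule subgroupI)
  show "centralizer G s \<noteq> {}" using assms by (auto simp: centralizer_iff)
next
  fix x assume "x \<in> centralizer G s"
  then have x: "x \<in> carrier G" "x \<otimes> s = s \<otimes> x" by (simp_all add: centralizer_iff)
  then have "inv x \<otimes> (x \<otimes> s) \<otimes> inv x = inv x \<otimes> (s \<otimes> x) \<otimes> inv x" by simp
  then show "inv x \<in> centralizer G s" using x(1) assms by (simp add: centralizer_iff m_assoc)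
next
  fix x y assume "x \<in> centralizer G s" "y \<in> centralizer G s"
  then have x: "x \<in> carrier G" "x \<otimes> s = s \<otimes> x" and y: "y \<in> carrier G" "y \<otimes> s = s \<otimes> y"
    by (simp_all add: centralizer_iff)
  have "x \<otimes> y \<otimes> s = x \<otimes> s \<otimes> y" using x(1) y assms by (simp add: m_assoc)
  also have "\<dots> = s \<otimes> (x \<otimes> y)" using x y(1) assms by (simp add: m_assoc)
  finally show "x \<otimes> y \<in> centralizer G s" using x y by (simp add: centralizer_iff)
qed (auto simp: centralizer_iff)

lemma centralizer_conj:
  assumes "x \<in> centralizer G s" "s \<in> carrier G"
  shows "inv x \<otimes> s \<otimes> x = s" "x \<otimes> s \<otimes> inv x = s"
proof -
  have x: "x \<in> carrier G" "x \<otimes> s = s \<otimes> x" using assms by (simp_all add: centralizer_iff)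
  then show "inv x \<otimes> s \<otimes> x = s" using assms(2) by (simp add: m_assoc flip: x(2))
  show "x \<otimes> s \<otimes> inv x = s" using x assms(2) by (simp add: m_assoc)
qed

lemma commuting_reflections_conj_iff:
  assumes x: "x \<in> centralizer G s" and s: "s \<in> carrier G" and t: "t \<in> carrier G"
  shows "inv x \<otimes> t \<otimes> x \<in> commuting_reflections s \<longleftrightarrow> t \<in> commuting_reflections s"
proof
  have xc: "x \<in> carrier G" "s \<otimes> x = x \<otimes> s" using x by (simp_all add: centralizer_iff)
  have ic: "s \<otimes> inv x = inv x \<otimes> s"
    using subgroup.m_inv_closed[OF centralizer_subgroup[OF s] x] by (simp add: centralizer_iff)
  show "inv x \<otimes> t \<otimes> x \<in> commuting_reflections s" if "t \<in> commuting_reflections s"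
    using commuting_reflections_conj[OF xc(1) s s xc(2) that] .
  assume "inv x \<otimes> t \<otimes> x \<in> commuting_reflections s"
  from commuting_reflections_conj[OF _ s s ic this]
  show "t \<in> commuting_reflections s" using xc(1) t by (simp add: m_assoc)
qed

text \<open>Conjugation by \<open>x\<close> fixes \<open>s\<close>, so on the centralizer the
  condition \<open>s \<in> N x\<close> is a homomorphism to a group of order two; its kernel is
  \<open>positive_centralizer s\<close>.\<close>

lemma base_inversion_mult:
  assumes "x \<in> centralizer G s" "y \<in> carrier G" "s \<in> carrier G"
  shows "s \<in> N (x \<otimes> y) \<longleftrightarrow> (s \<in> N x) \<noteq> (s \<in> N y)"
  using N_mult[of x y s] centralizer_conj[of x s] assms by (simp add: centralizer_iff)

lemma base_inversion_inv:
  assumes "x \<in> centralizer G s" "s \<in> carrier G"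
  shows "s \<in> N (inv x) \<longleftrightarrow> s \<in> N x"
  using N_inv[of x s] centralizer_conj[of x s] assms by (simp add: centralizer_iff)

lemma positive_centralizer_subgroup:
  assumes "s \<in> carrier G"
  shows "subgroup (positive_centralizer s) G"
proof -
  interpret C: subgroup "centralizer G s" G by (rule centralizer_subgroup[OF assms])
  show ?thesis
  proof (rule subgroupI)
    have "\<one> \<in> positive_centralizer s" using C.one_closed by (simp add: positive_centralizer_def)
    then show "positive_centralizer s \<noteq> {}" by blast
  qed (use assms base_inversion_inv base_inversion_mult in
      \<open>auto simp: positive_centralizer_def\<close>)
qed

lemma commuting_reflections_positive:
  assumes "s \<in> carrier G"
  shows "commuting_reflections s \<subseteq> positive_centralizer s"
  using assms commuting_inversion[of _ s] reflections_carrier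
  by (auto simp: positive_centralizer_def commuting_reflections_iff centralizer_iff)

section \<open>Path reflections and factorization in the centralizer\<close>

lemma path_reflection_eq:
  assumes "evenly_joined G R (last \<gamma>) u"
  shows "path_reflection G \<gamma> u = path_elt G \<gamma> \<otimes> transporter (last \<gamma>) u \<otimes> inv (path_elt G \<gamma>)"
  using assms transporter_even[of "last \<gamma>" u] ord_commute[of u "last \<gamma>"]
  by (simp add: path_reflection_def evenly_joined_def)

text \<open>In r = p e p\<inverse> neither outer factor contributes an inversion commuting with the
  start of the path, by \<open>path_elt_facts\<close>, and the only relevant inversion of the
  transporter e is e itself.\<close>

lemma path_reflection_inversions:
  assumes path: "edge_path R (odd_joined G R) \<gamma>" and u: "evenly_joined G R (last \<gamma>) u"
  defines "r \<equiv> path_reflection G \<gamma> u"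
  shows "r \<in> commuting_reflections (hd \<gamma>)" "N r \<inter> commuting_reflections (hd \<gamma>) = {r}"
proof -
  define a where "a = hd \<gamma>"
  define b where "b = last \<gamma>"
  define p where "p = path_elt G \<gamma>"
  define e where "e = transporter b u"
  have R: "a \<in> R" "b \<in> R" "u \<in> R" "set \<gamma> \<subseteq> R" using path u
    by (auto simp: a_def b_def edge_path_def evenly_joined_def)
  have pc: "p \<in> carrier G" using R by (simp add: p_def)
  have ev: "even (ord (u \<otimes> b))" "0 < ord (u \<otimes> b)"
    using u ord_commute[of u b] R by (simp_all add: evenly_joined_def b_def)
  have ap: "a \<otimes> p = p \<otimes> b" and Np: "N p \<inter> commuting_reflections a = {}"
    using path_elt_facts[OF path] by (simp_all add: a_def b_def p_def)
  have e: "e \<in> commuting_reflections b"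
    unfolding e_def using transporter_commuting_reflection R ev by simp
  then have er: "e \<in> reflections G R" "e \<otimes> b = b \<otimes> e" "e \<in> carrier G" "e \<otimes> e = \<one>"
    using reflections_carrier reflection_square by (auto simp: commuting_reflections_iff)
  have ei: "inv e = e" using er inv_equality by simp
  have r: "r = p \<otimes> e \<otimes> inv p" using path_reflection_eq[OF u] by (simp add: r_def p_def e_def b_def)
  have "inv p \<otimes> (a \<otimes> p) \<otimes> inv p = inv p \<otimes> (p \<otimes> b) \<otimes> inv p" using ap by simp
  then have bp: "b \<otimes> inv p = inv p \<otimes> a" using pc R by (simp add: m_assoc)
  have pull: "p \<otimes> t \<otimes> inv p \<in> commuting_reflections a" if "t \<in> commuting_reflections b" for t
    using commuting_reflections_conj[OF _ _ _ bp that] pc R by simp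
  show rc: "r \<in> commuting_reflections (hd \<gamma>)" using pull[OF e] r by (simp add: a_def)
  have "t \<in> N r \<longleftrightarrow> t = r" if t: "t \<in> commuting_reflections a" for t
  proof -
    have tc: "t \<in> carrier G" using t reflections_carrier by (simp add: commuting_reflections_iff)
    define q where "q = inv p \<otimes> t \<otimes> p"
    have q: "q \<in> commuting_reflections b"
      unfolding q_def using commuting_reflections_conj[OF pc _ _ ap t] R by simp
    then have qc: "q \<in> carrier G" "q \<otimes> b = b \<otimes> q"
      using reflections_carrier by (auto simp: commuting_reflections_iff)
    have "t \<in> N r \<longleftrightarrow> (t \<in> N p) \<noteq> (q \<in> N (e \<otimes> inv p))"
      using N_mult[of p "e \<otimes> inv p" t] pc er tc by (simp add: r q_def m_assoc)
    also have "t \<in> N p \<longleftrightarrow> False" using Np t by blast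
    also have "q \<in> N (e \<otimes> inv p) \<longleftrightarrow> (q \<in> N e) \<noteq> (e \<otimes> q \<otimes> e \<in> N (inv p))"
      using N_mult[of e "inv p" q] pc er qc ei by simp
    also have "e \<otimes> q \<otimes> e \<in> N (inv p) \<longleftrightarrow> p \<otimes> (e \<otimes> q \<otimes> e) \<otimes> inv p \<in> N p"
      using N_inv[of p "e \<otimes> q \<otimes> e"] pc er qc by simp
    also have "\<dots> \<longleftrightarrow> False"
    proof -
      have "e \<otimes> q \<otimes> e \<in> commuting_reflections b"
        using commuting_reflections_conj[OF er(3) _ _ er(2)[symmetric] q] R ei by simp
      then show ?thesis using pull Np by blast
    qed
    also have "q \<in> N e \<longleftrightarrow> q = e"
    proof
      assume "q \<in> N e"
      then show "q = e" using N_transporter_commuting(2)[OF R(2,3)] qc by (simp add: e_def)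
    qed (use reflection_in_N[OF er(1)] in simp)
    also have "q = e \<longleftrightarrow> t = r"
    proof
      have "t = p \<otimes> q \<otimes> inv p" using pc tc by (simp add: q_def m_assoc)
      moreover assume "q = e"
      ultimately show "t = r" using r by simp
    next
      assume "t = r"
      then show "q = e" using pc er by (simp add: r q_def m_assoc)
    qed
    finally show ?thesis by blast
  qed
  then show "N r \<inter> commuting_reflections (hd \<gamma>) = {r}" using rc by (auto simp: a_def)
qed

lemma path_reflections_iff:
  "r \<in> path_reflections G R s \<longleftrightarrow> (\<exists>\<gamma> u. edge_path R (odd_joined G R) \<gamma> \<and> hd \<gamma> = s \<and>
    evenly_joined G R (last \<gamma>) u \<and> r = path_reflection G \<gamma> u)"
  by (auto simp: path_reflections_def)

lemma path_reflections_facts: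
  assumes "r \<in> path_reflections G R s"
  shows "r \<in> commuting_reflections s" "N r \<inter> commuting_reflections s = {r}"
proof -
  obtain \<gamma> u where "edge_path R (odd_joined G R) \<gamma>" "hd \<gamma> = s" "evenly_joined G R (last \<gamma>) u"
    "r = path_reflection G \<gamma> u"
    using assms by (auto simp: path_reflections_iff)
  then show "r \<in> commuting_reflections s" "N r \<inter> commuting_reflections s = {r}"
    using path_reflection_inversions[of \<gamma> u] by simp_all
qed

text \<open>After an odd edge the remaining factor no longer commutes with \<open>s\<close>; it
  conjugates the current endpoint to \<open>b\<close>. The induction therefore carries the path
  \<open>\<delta>\<close> walked so far: odd edges extend it, even ones emit a path
  reflection.\<close>

lemma path_factorization:
  assumes "edge_path R (odd_joined G R) \<delta>" "hd \<delta> = s" "w \<in> carrier G" "b \<in> R"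
    and "last \<delta> \<otimes> w = w \<otimes> b" "last \<delta> \<notin> N w"
  shows "\<exists>x \<in> generate G (path_reflections G R s). \<exists>\<gamma>. edge_path R (odd_joined G R) \<gamma> \<and>
    hd \<gamma> = s \<and> last \<gamma> = b \<and> path_elt G \<delta> \<otimes> w = x \<otimes> path_elt G \<gamma>"
  using assms
proof (induction "len w" arbitrary: w \<delta> rule: less_induct)
  case less
  define a where "a = last \<delta>"
  define p where "p = path_elt G \<delta>"
  have \<delta>R: "set \<delta> \<subseteq> R" "\<delta> \<noteq> []" "a \<in> R" using less.prems(1) by (auto simp: edge_path_def a_def)
  have pc: "p \<in> carrier G" using \<delta>R by (simp add: p_def)
  show ?case
  proof (cases "w = \<one>")
    case True
    then have "last \<delta> = b" using less.prems \<delta>R by (simp add: a_def)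
    then show ?thesis using less.prems True pc
      by (intro bexI[of _ \<one>] exI[of _ \<delta>]) (auto simp: p_def intro: generate.one)
  next
    case False
    then obtain u where u: "u \<in> R" "u \<in> N w"
      using exists_descent[of R w] less.prems(3) R_generate by auto
    define e where "e = transporter a u"
    have ec: "e \<in> carrier G" using transporter_carrier \<delta>R u by (simp add: e_def)
    obtain y where y: "y \<in> carrier G" "w = e \<otimes> y" "u \<noteq> a" "0 < ord (u \<otimes> a)" "len y < len w"
      "(if odd (ord (u \<otimes> a)) then u else a) \<otimes> y = y \<otimes> b"
      "(if odd (ord (u \<otimes> a)) then u else a) \<notin> N y"
      using transporter_factor[OF less.prems(3) \<delta>R(3) less.prems(4) _ _ u] less.prems(5,6)
      unfolding a_def e_def by metis
    have ordc: "ord (a \<otimes> u) = ord (u \<otimes> a)" using ord_commute u \<delta>R by simp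
    show ?thesis
    proof (cases "odd (ord (u \<otimes> a))")
      case True
      then have au: "odd_joined G R a u" using y u \<delta>R ordc by (auto simp: odd_joined_iff)
      then have "edge_path R (odd_joined G R) (\<delta> @ [u])"
        using edge_path_snoc less.prems(1) u by (auto simp: a_def)
      moreover have "path_elt G (\<delta> @ [u]) = p \<otimes> e"
      proof -
        have "path_elt G (\<delta> @ tl [a, u]) = path_elt G \<delta> \<otimes> path_elt G [a, u]"
          using \<delta>R u by (intro path_elt_append) (simp_all add: a_def)
        also have "path_elt G [a, u] = e"
          unfolding path_elt_transporter[OF au] using ec by (simp add: e_def)
        finally show ?thesis by (simp add: p_def)
      qed
      moreover have "p \<otimes> e \<otimes> y = p \<otimes> w" using y pc ec by (simp add: m_assoc)
      ultimately show ?thesis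
        using less.hyps[OF y(5), of "\<delta> @ [u]"] less.prems(2,4) y True \<delta>R by (simp add: p_def)
    next
      case False
      then have au: "evenly_joined G R (last \<delta>) u" using y u \<delta>R ordc by (simp add: evenly_joined_def a_def)
      then have r: "p \<otimes> e \<otimes> inv p \<in> path_reflections G R s"
        using less.prems(1,2) path_reflection_eq[OF au]
        unfolding path_reflections_iff p_def e_def a_def by metis
      obtain x \<gamma> where x: "x \<in> generate G (path_reflections G R s)" and
        \<gamma>: "edge_path R (odd_joined G R) \<gamma>" "hd \<gamma> = s" "last \<gamma> = b" "p \<otimes> y = x \<otimes> path_elt G \<gamma>"
        using less.hyps[OF y(5), of \<delta>] less.prems(1,2,4) y(1,6,7) False by (auto simp: p_def a_def)
      have Pc: "path_reflections G R s \<subseteq> carrier G"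
        using path_reflections_facts(1) reflections_carrier by (auto simp: commuting_reflections_iff)
      have xc: "x \<in> carrier G" using generate_in_carrier[OF Pc x] .
      have gc: "path_elt G \<gamma> \<in> carrier G" using \<gamma> by (simp add: edge_path_def)
      \<comment> \<open>The reflection is moved to the left of the path element, where it joins
        \<open>x\<close>.\<close>
      have "p \<otimes> w = p \<otimes> e \<otimes> inv p \<otimes> (p \<otimes> y)" using y pc ec by (simp add: m_assoc)
      also have "\<dots> = (p \<otimes> e \<otimes> inv p \<otimes> x) \<otimes> path_elt G \<gamma>"
        unfolding \<gamma>(4) using pc ec xc gc by (simp add: m_assoc)
      finally show ?thesis
        using generate.eng[OF generate.incl[OF r] x] \<gamma> unfolding p_def by blast
    qed
  qed
qed

text \<open>Concatenation and reversal of loops give products and inverses, so the path elements of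
  loops are already closed as a subgroup.\<close>

lemma Gamma_Omega_eq:
  assumes s: "s \<in> R"
  shows "Gamma_Omega G R s = path_elt G ` edge_loops R (odd_joined G R) s"
    and "subgroup (Gamma_Omega G R s) G"
proof -
  let ?L = "edge_loops R (odd_joined G R) s"
  have LR: "set \<gamma> \<subseteq> R" "\<gamma> \<noteq> []" "hd \<gamma> = s" "last \<gamma> = s" "edge_path R (odd_joined G R) \<gamma>"
    if "\<gamma> \<in> ?L" for \<gamma> using that by (auto simp: edge_loops_def edge_path_def)
  have sub: "subgroup (path_elt G ` ?L) G"
  proof (rule subgroupI)
    show "path_elt G ` ?L \<subseteq> carrier G" using LR by auto
    have "[s] \<in> ?L" using s by (simp add: edge_loops_def)
    then show "path_elt G ` ?L \<noteq> {}" by blast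
  next
    fix x assume "x \<in> path_elt G ` ?L"
    then obtain \<gamma> where "\<gamma> \<in> ?L" "x = path_elt G \<gamma>" by blast
    then show "inv x \<in> path_elt G ` ?L"
      using path_elt_rev[OF LR(5)] edge_loops_rev[OF symp_odd_joined] by (metis imageI)
  next
    fix x y assume "x \<in> path_elt G ` ?L" "y \<in> path_elt G ` ?L"
    then obtain \<gamma> \<delta> where "\<gamma> \<in> ?L" "x = path_elt G \<gamma>" "\<delta> \<in> ?L" "y = path_elt G \<delta>" by blast
    then show "x \<otimes> y \<in> path_elt G ` ?L"
      using path_elt_append[of \<gamma> \<delta>] LR edge_loops_append[of \<gamma> _ _ s \<delta>] by (metis imageI)
  qed
  show "Gamma_Omega G R s = path_elt G ` ?L"
    unfolding Gamma_Omega_def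
    by (intro equalityI generate_subgroup_incl[OF order_refl sub] subsetI generate.incl)
  then show "subgroup (Gamma_Omega G R s) G" using sub by simp
qed

lemma Gamma_Omega_facts:
  assumes s: "s \<in> R" and x: "x \<in> Gamma_Omega G R s"
  shows "x \<in> positive_centralizer s" "N x \<inter> commuting_reflections s = {}"
proof -
  obtain \<gamma> where \<gamma>: "edge_path R (odd_joined G R) \<gamma>" "hd \<gamma> = s" "last \<gamma> = s" "x = path_elt G \<gamma>"
    using x Gamma_Omega_eq[OF s] by (auto simp: edge_loops_def)
  moreover have "x \<in> carrier G" using \<gamma> by (simp add: edge_path_def)
  ultimately show "x \<in> positive_centralizer s" "N x \<inter> commuting_reflections s = {}"
    using path_elt_facts[OF \<gamma>(1)] by (simp_all add: positive_centralizer_def centralizer_iff)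
qed

lemma W_Omega_commuting: "W_Omega G R s = generate G (commuting_reflections s)"
  by (simp add: W_Omega_def commuting_reflections_def)

text \<open>Factor \<open>t = x \<otimes> p\<close> with \<open>p\<close> a path element. As
  \<open>t\<close> is an inversion of itself and \<open>p\<close> has no commuting inversions,
  \<open>t\<close> is an inversion of \<open>x\<close>. By the cocycle rule, \<open>NP\<close>, all
  commuting inversions of \<open>x\<close> lie in the subgroup generated by path
  reflections.\<close>

lemma commuting_reflections_subset_generate:
  assumes s: "s \<in> R"
  shows "commuting_reflections s \<subseteq> generate G (path_reflections G R s)"
proof
  let ?D = "commuting_reflections s" and ?P = "path_reflections G R s"
  have sc: "s \<in> carrier G" using s by simp
  have PD: "?P \<subseteq> ?D" using path_reflections_facts by blast
  have Dc: "?D \<subseteq> carrier G" using reflections_carrier by (auto simp: commuting_reflections_iff)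
  interpret H: subgroup "positive_centralizer s" G by (rule positive_centralizer_subgroup[OF sc])
  interpret P: subgroup "generate G ?P" G using generate_is_subgroup PD Dc by blast
  have PH: "generate G ?P \<subseteq> positive_centralizer s"
    using generate_subgroup_incl[OF _ H.subgroup_axioms] PD commuting_reflections_positive[OF sc] by blast
  have HC: "x \<in> centralizer G s" if "x \<in> positive_centralizer s" for x
    using that by (simp add: positive_centralizer_def)
  have NP: "N x \<inter> ?D \<subseteq> generate G ?P" if "x \<in> generate G ?P" for x
    using that
  proof induction
    case (incl h)
    then show ?case using path_reflections_facts(2)[OF incl] generate.incl[OF incl] by simp
  next
    case (inv h)
    then have "h \<in> reflections G R" using PD by (auto simp: commuting_reflections_iff)
    then have "inv h = h" using reflection_square reflections_carrier inv_equality by simp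
    then show ?case using path_reflections_facts(2)[OF inv] generate.incl[OF inv] by simp
  next
    case (eng h1 h2)
    show ?case
    proof
      fix t assume t: "t \<in> N (h1 \<otimes> h2) \<inter> ?D"
      have c: "h1 \<in> carrier G" "h2 \<in> carrier G" "t \<in> carrier G" using eng t Dc by auto
      show "t \<in> generate G ?P"
      proof (cases "t \<in> N h1")
        case False
        then have "inv h1 \<otimes> t \<otimes> h1 \<in> N h2" using N_mult[OF c] t by blast
        then have "inv h1 \<otimes> t \<otimes> h1 \<in> generate G ?P"
          using commuting_reflections_conj_iff[OF _ sc c(3)] eng PH HC t by blast
        then have "h1 \<otimes> (inv h1 \<otimes> t \<otimes> h1) \<otimes> inv h1 \<in> generate G ?P" using eng by simp
        then show ?thesis using c by (simp add: m_assoc)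
      qed (use eng t in blast)
    qed
  qed simp
  fix t assume t: "t \<in> ?D"
  have tc: "t \<in> carrier G" using t Dc by blast
  have "t \<in> positive_centralizer s" using t commuting_reflections_positive[OF sc] by blast
  then have "s \<otimes> t = t \<otimes> s" "s \<notin> N t"
    unfolding positive_centralizer_iff by metis+
  then obtain x \<gamma> where x: "x \<in> generate G ?P" and \<gamma>: "edge_path R (odd_joined G R) \<gamma>" "hd \<gamma> = s"
    "t = x \<otimes> path_elt G \<gamma>"
    using path_factorization[of "[s]" s t s] s tc by auto
  have c: "x \<in> carrier G" "path_elt G \<gamma> \<in> carrier G" using x \<gamma> by (auto simp: edge_path_def)
  have "inv x \<otimes> t \<otimes> x \<in> ?D" using commuting_reflections_conj_iff[OF _ sc tc] x PH HC t by blast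
  then have "inv x \<otimes> t \<otimes> x \<notin> N (path_elt G \<gamma>)" using path_elt_facts(3)[OF \<gamma>(1)] \<gamma>(2) by blast
  moreover have "t \<in> N (x \<otimes> path_elt G \<gamma>)"
    using reflection_in_N[of t] t \<gamma>(3) by (simp add: commuting_reflections_iff)
  ultimately have "t \<in> N x" using N_mult[OF c tc] by blast
  then show "t \<in> generate G ?P" using NP[OF x] t by blast
qed

lemma W_Omega_facts:
  assumes s: "s \<in> R"
  shows "W_Omega G R s = generate G (path_reflections G R s)"
    and "subgroup (W_Omega G R s) G"
    and "W_Omega G R s \<subseteq> positive_centralizer s"
    and "commuting_reflections s \<subseteq> W_Omega G R s"
proof -
  let ?D = "commuting_reflections s" and ?P = "path_reflections G R s"
  have sc: "s \<in> carrier G" using s by simp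
  have Dc: "?D \<subseteq> carrier G" using reflections_carrier by (auto simp: commuting_reflections_iff)
  have PD: "?P \<subseteq> ?D" using path_reflections_facts by blast
  have "subgroup (generate G ?P) G" using generate_is_subgroup PD Dc by blast
  then have "generate G ?D \<subseteq> generate G ?P"
    using generate_subgroup_incl commuting_reflections_subset_generate[OF s] by blast
  then show "W_Omega G R s = generate G ?P"
    using mono_generate[OF PD] by (auto simp: W_Omega_commuting)
  show "subgroup (W_Omega G R s) G"
    using generate_is_subgroup[OF Dc] by (simp add: W_Omega_commuting)
  show "W_Omega G R s \<subseteq> positive_centralizer s"
    using generate_subgroup_incl[OF commuting_reflections_positive[OF sc] positive_centralizer_subgroup[OF sc]]
    by (simp add: W_Omega_commuting)
  show "?D \<subseteq> W_Omega G R s" by (auto simp: W_Omega_commuting intro: generate.incl)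
qed

lemma W_Omega_reflection_cocycle:
  assumes s: "s \<in> R"
  shows "reflection_cocycle (G\<lparr>carrier := W_Omega G R s\<rparr>) (path_reflections G R s)
    (\<lambda>x. N x \<inter> commuting_reflections s)"
proof -
  let ?D = "commuting_reflections s" and ?P = "path_reflections G R s" and ?W = "W_Omega G R s"
  note W = W_Omega_facts[OF s]
  have sc: "s \<in> carrier G" using s by simp
  interpret W: subgroup ?W G by (rule W(2))
  interpret WG: group "G\<lparr>carrier := ?W\<rparr>" by (rule W.subgroup_is_group[OF is_group])
  have PW: "?P \<subseteq> ?W" using W(1) by (auto intro: generate.incl)
  show ?thesis
  proof
    show "?P \<subseteq> carrier (G\<lparr>carrier := ?W\<rparr>)" using PW by simp
    show "generate (G\<lparr>carrier := ?W\<rparr>) ?P = carrier (G\<lparr>carrier := ?W\<rparr>)"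
      using generate_consistent[OF PW W.subgroup_axioms] W(1) by simp
  next
    fix r assume "r \<in> ?P"
    then have r: "r \<in> ?D" "N r \<inter> ?D = {r}" using path_reflections_facts by auto
    then show "r \<otimes>\<^bsub>G\<lparr>carrier := ?W\<rparr>\<^esub> r = \<one>\<^bsub>G\<lparr>carrier := ?W\<rparr>\<^esub>"
      using reflection_square by (simp add: commuting_reflections_iff)
    show "N r \<inter> ?D = {r}" by (rule r(2))
  next
    fix x assume "x \<in> carrier (G\<lparr>carrier := ?W\<rparr>)"
    \<comment> \<open>The values of the restricted cocycle must be subsets of the smaller group,
      which holds since that group contains all of \<open>?D\<close>.\<close>
    show "N x \<inter> ?D \<subseteq> carrier (G\<lparr>carrier := ?W\<rparr>)" using W(4) by auto
  next
    fix x y t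
    assume "x \<in> carrier (G\<lparr>carrier := ?W\<rparr>)" "y \<in> carrier (G\<lparr>carrier := ?W\<rparr>)" "t \<in> carrier (G\<lparr>carrier := ?W\<rparr>)"
    then have xW: "x \<in> ?W" and c: "x \<in> carrier G" "y \<in> carrier G" "t \<in> carrier G" by auto
    have "x \<in> centralizer G s" using xW W(3) by (auto simp: positive_centralizer_def)
    then show "t \<in> N (x \<otimes>\<^bsub>G\<lparr>carrier := ?W\<rparr>\<^esub> y) \<inter> ?D \<longleftrightarrow>
        (t \<in> N x \<inter> ?D) \<noteq>
        (inv\<^bsub>G\<lparr>carrier := ?W\<rparr>\<^esub> x \<otimes>\<^bsub>G\<lparr>carrier := ?W\<rparr>\<^esub> t \<otimes>\<^bsub>G\<lparr>carrier := ?W\<rparr>\<^esub> x \<in> N y \<inter> ?D)"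
      using N_mult[OF c] commuting_reflections_conj_iff[OF _ sc c(3)] m_inv_consistent[OF W.subgroup_axioms xW]
      by auto
  qed
qed

text \<open>The hypothesis says that \<open>x\<close> has length 0 with respect to the path
  reflections.\<close>

lemma W_Omega_trivialI:
  assumes s: "s \<in> R" and x: "x \<in> W_Omega G R s" "N x \<inter> commuting_reflections s = {}"
  shows "x = \<one>"
  using reflection_cocycle.len_eq_0D[OF W_Omega_reflection_cocycle[OF s], of x] x by simp

lemma W_Omega_conj:
  assumes s: "s \<in> R" and x: "x \<in> centralizer G s" and h: "h \<in> W_Omega G R s"
  shows "x \<otimes> h \<otimes> inv x \<in> W_Omega G R s"
proof -
  let ?D = "commuting_reflections s"
  have sc: "s \<in> carrier G" using s by simp
  have xc: "x \<in> carrier G" using x by (simp add: centralizer_iff)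
  have Dc: "?D \<subseteq> carrier G" using reflections_carrier by (auto simp: commuting_reflections_iff)
  have D: "x \<otimes> t \<otimes> inv x \<in> ?D" if "t \<in> ?D" for t
    using commuting_reflections_conj_iff[OF x sc, of "x \<otimes> t \<otimes> inv x"] that Dc xc by (auto simp: m_assoc)
  from h have "h \<in> generate G ?D" by (simp add: W_Omega_commuting)
  then have "x \<otimes> h \<otimes> inv x \<in> generate G ?D"
  proof induction
    case one
    then show ?case using xc by (simp add: generate.one)
  next
    case (incl t)
    then show ?case using D generate.incl by metis
  next
    case (inv t)
    then have "inv t = t"
      using reflection_square reflections_carrier inv_equality by (simp add: commuting_reflections_iff)
    then show ?case using D[OF inv] generate.incl by metis
  next
    case (eng h1 h2)
    have "x \<otimes> (h1 \<otimes> h2) \<otimes> inv x = (x \<otimes> h1 \<otimes> inv x) \<otimes> (x \<otimes> h2 \<otimes> inv x)"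
      using generate_in_carrier[OF Dc] eng.hyps xc by (simp add: m_assoc)
    then show ?case using generate.eng eng.IH by metis
  qed
  then show ?thesis by (simp add: W_Omega_commuting)
qed

lemma positive_centralizer_eq:
  assumes s: "s \<in> R"
  shows "W_Omega G R s <#> Gamma_Omega G R s = positive_centralizer s"
proof
  interpret H: subgroup "positive_centralizer s" G
    by (rule positive_centralizer_subgroup) (use s in simp)
  show "W_Omega G R s <#> Gamma_Omega G R s \<subseteq> positive_centralizer s"
    using W_Omega_facts(3)[OF s] Gamma_Omega_facts(1)[OF s] by (auto simp: set_mult_def)
  show "positive_centralizer s \<subseteq> W_Omega G R s <#> Gamma_Omega G R s"
  proof
    fix w assume "w \<in> positive_centralizer s"
    then have w: "w \<in> carrier G" "s \<otimes> w = w \<otimes> s" "s \<notin> N w"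
      unfolding positive_centralizer_iff by metis+
    then obtain x \<gamma> where "x \<in> generate G (path_reflections G R s)" "edge_path R (odd_joined G R) \<gamma>"
      "hd \<gamma> = s" "last \<gamma> = s" "w = x \<otimes> path_elt G \<gamma>"
      using path_factorization[of "[s]" s w s] s by auto
    then show "w \<in> W_Omega G R s <#> Gamma_Omega G R s"
      unfolding set_mult_def W_Omega_facts(1)[OF s] Gamma_Omega_eq(1)[OF s] edge_loops_def by blast
  qed
qed

text \<open>The intersection is trivial because elements of \<open>Gamma_Omega\<close> have no
  inversion among the reflections that measure length in \<open>W_Omega\<close>.\<close>

lemma semidirect_W_Omega_Gamma_Omega:
  assumes s: "s \<in> R"
  shows "internal_semidirect_product G (W_Omega G R s <#> Gamma_Omega G R s)
    (W_Omega G R s) (Gamma_Omega G R s)"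
proof -
  let ?W = "W_Omega G R s" and ?\<Gamma> = "Gamma_Omega G R s" and ?H = "positive_centralizer s"
  have sub: "subgroup ?H G" by (rule positive_centralizer_subgroup) (use s in simp)
  have "?W \<lhd> (G\<lparr>carrier := ?H\<rparr>)"
    using W_Omega_facts(2,3)[OF s] W_Omega_conj[OF s] sub
    by (intro normal_subgroupI) (auto simp: positive_centralizer_def)
  moreover have "subgroup ?\<Gamma> (G\<lparr>carrier := ?H\<rparr>)"
    using subgroup_incl[OF Gamma_Omega_eq(2)[OF s] sub] Gamma_Omega_facts(1)[OF s] by blast
  moreover have "?W \<inter> ?\<Gamma> = {\<one>}"
    using W_Omega_trivialI[OF s] Gamma_Omega_facts(2)[OF s] W_Omega_facts(2)[OF s]
      Gamma_Omega_eq(2)[OF s] by (auto dest: subgroup.one_closed)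
  ultimately show ?thesis
    unfolding internal_semidirect_product_def using sub positive_centralizer_eq[OF s] by simp
qed

text \<open>The kernel of the sign from \<open>base_inversion_mult\<close> is complemented by the
  central involution \<open>s\<close>, which lies outside it.\<close>

lemma direct_centralizer:
  assumes s: "s \<in> R"
  shows "internal_direct_product G (centralizer G s) (generate G {s}) (positive_centralizer s)"
proof -
  let ?C = "centralizer G s" and ?H = "positive_centralizer s"
  have sc: "s \<in> carrier G" using s by simp
  interpret C: subgroup ?C G by (rule centralizer_subgroup[OF sc])
  interpret H: subgroup ?H G by (rule positive_centralizer_subgroup[OF sc])
  have "x = \<one> \<or> x = s" if "x \<in> generate G {s}" for x
    using that by induction (use s in auto)
  then have gen: "generate G {s} = {\<one>, s}" by (auto intro: generate.one generate.incl)
  have ss: "subgroup {\<one>, s} G" using generate_is_subgroup[of "{s}"] sc gen by simp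
  have sN: "s \<in> N s" using N_generator[OF s] by simp
  have sC: "s \<in> ?C" using sc by (simp add: centralizer_iff)
  have HC: "?H \<subseteq> ?C" by (auto simp: positive_centralizer_def)
  have "{\<one>, s} \<lhd> (G\<lparr>carrier := ?C\<rparr>)"
  proof (intro normal_subgroupI C.subgroup_axioms ss)
    fix x h assume x: "x \<in> ?C" and h: "h \<in> {\<one>, s}"
    then show "x \<otimes> h \<otimes> inv x \<in> {\<one>, s}" using centralizer_conj(2)[OF x sc] C.mem_carrier[OF x] by auto
  qed (use sC in auto)
  moreover have "?H \<lhd> (G\<lparr>carrier := ?C\<rparr>)"
  proof (intro normal_subgroupI C.subgroup_axioms H.subgroup_axioms HC)
    fix x h assume x: "x \<in> ?C" and h: "h \<in> ?H"
    then have hC: "h \<in> ?C" "s \<notin> N h" by (auto simp: positive_centralizer_def)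
    have "s \<in> N (x \<otimes> h \<otimes> inv x) \<longleftrightarrow> ((s \<in> N x) \<noteq> (s \<in> N h)) \<noteq> (s \<in> N x)"
      using base_inversion_mult[of "x \<otimes> h" s "inv x"] base_inversion_mult[of x s h]
        base_inversion_inv[of x s] x hC(1) sc by simp
    then show "x \<otimes> h \<otimes> inv x \<in> ?H" using hC x by (simp add: positive_centralizer_def)
  qed
  moreover have "{\<one>, s} <#> ?H = ?C"
  proof
    show "{\<one>, s} <#> ?H \<subseteq> ?C" using sC HC by (auto simp: set_mult_def)
    show "?C \<subseteq> {\<one>, s} <#> ?H"
    proof
      fix x assume x: "x \<in> ?C"
      show "x \<in> {\<one>, s} <#> ?H"
      proof (cases "s \<in> N x")
        case False
        then have "x \<in> ?H" "x = \<one> \<otimes> x" using x by (auto simp: positive_centralizer_def)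
        then show ?thesis unfolding set_mult_def by blast
      next
        case True
        then have "s \<otimes> x \<in> ?H"
          using x sC base_inversion_mult[OF sC _ sc, of x] sN by (simp add: positive_centralizer_def)
        moreover have "x = s \<otimes> (s \<otimes> x)" using x s by simp
        ultimately show ?thesis unfolding set_mult_def by blast
      qed
    qed
  qed
  moreover have "{\<one>, s} \<inter> ?H = {\<one>}" using sN by (auto simp: positive_centralizer_def)
  ultimately show ?thesis
    unfolding internal_direct_product_def gen using C.subgroup_axioms by simp
qed

lemma fundamental_group_iso:
  assumes s: "s \<in> R"
  shows "\<exists>\<phi> \<in> iso (graph_fundamental_group R (odd_joined G R) s) (G\<lparr>carrier := Gamma_Omega G R s\<rparr>).
    \<forall>\<gamma> \<in> edge_loops R (odd_joined G R) s. \<phi> (loop_class R (odd_joined G R) s \<gamma>) = path_elt G \<gamma>"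
proof -
  let ?E = "odd_joined G R"
  let ?L = "edge_loops R ?E s" and ?c = "loop_class R ?E s"
  let ?\<pi> = "graph_fundamental_group R ?E s"
  have LR: "set \<gamma> \<subseteq> R" "\<gamma> \<noteq> []" "hd \<gamma> = s" "last \<gamma> = s" "edge_path R ?E \<gamma>"
    if "\<gamma> \<in> ?L" for \<gamma> using that by (auto simp: edge_loops_def edge_path_def)
  have "equivclp (backtrack_step ?E) \<gamma> \<delta> \<longleftrightarrow> path_elt G \<delta> = path_elt G \<gamma>" if "\<gamma> \<in> ?L" "\<delta> \<in> ?L" for \<gamma> \<delta>
    using path_elt_eq_iff[of \<gamma> \<delta>] LR(3,5)[OF that(1)] LR(3,5)[OF that(2)] by auto
  \<comment> \<open>Classes are exactly the fibres of \<open>path_elt\<close> on loops. This makes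
    \<open>\<phi>\<close> and the product well defined, and it also gives injectivity.\<close>
  then have cls: "?c \<gamma> = {\<delta> \<in> ?L. path_elt G \<delta> = path_elt G \<gamma>}" if "\<gamma> \<in> ?L" for \<gamma>
    using that by (auto simp: loop_class_def loop_homotopy_def)
  define \<phi> where "\<phi> A = the_elem (path_elt G ` A)" for A
  have \<phi>: "\<phi> (?c \<gamma>) = path_elt G \<gamma>" if "\<gamma> \<in> ?L" for \<gamma>
  proof -
    have "path_elt G ` ?c \<gamma> = {path_elt G \<gamma>}" using that by (auto simp: cls)
    then show ?thesis by (simp add: \<phi>_def)
  qed
  have car: "carrier ?\<pi> = ?c ` ?L"
    by (auto simp: graph_fundamental_group_def quotient_def loop_class_def)
  have app: "path_elt G (\<gamma> @ tl \<delta>) = path_elt G \<gamma> \<otimes> path_elt G \<delta>" "\<gamma> @ tl \<delta> \<in> ?L"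
    if "\<gamma> \<in> ?L" "\<delta> \<in> ?L" for \<gamma> \<delta>
    using path_elt_append[of \<gamma> \<delta>] LR that edge_loops_append[OF that] by auto
  have mult: "?c \<gamma> \<otimes>\<^bsub>?\<pi>\<^esub> ?c \<delta> = ?c (\<gamma> @ tl \<delta>)" if "\<gamma> \<in> ?L" "\<delta> \<in> ?L" for \<gamma> \<delta>
  proof -
    have eq: "?c (\<gamma>' @ tl \<delta>') = ?c (\<gamma> @ tl \<delta>)" if "\<gamma>' \<in> ?c \<gamma>" "\<delta>' \<in> ?c \<delta>" for \<gamma>' \<delta>'
      using that \<open>\<gamma> \<in> ?L\<close> \<open>\<delta> \<in> ?L\<close> app by (simp add: cls)
    have "?c \<gamma> \<otimes>\<^bsub>?\<pi>\<^esub> ?c \<delta> = (\<Union>\<gamma>'\<in>?c \<gamma>. \<Union>\<delta>'\<in>?c \<delta>. ?c (\<gamma>' @ tl \<delta>'))"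
      by (simp add: graph_fundamental_group_def)
    \<comment> \<open>All members of the union are the same class, so the union is that class once
      the index sets are known to be nonempty.\<close>
    also have "\<dots> = (\<Union>\<gamma>'\<in>?c \<gamma>. \<Union>\<delta>'\<in>?c \<delta>. ?c (\<gamma> @ tl \<delta>))"
      by (intro SUP_cong refl eq)
    also have "\<dots> = ?c (\<gamma> @ tl \<delta>)"
    proof -
      have "\<gamma> \<in> ?c \<gamma>" "\<delta> \<in> ?c \<delta>" using that by (simp_all add: cls)
      then have "?c \<gamma> \<noteq> {}" "?c \<delta> \<noteq> {}" by blast+
      then show ?thesis by (simp only: UN_constant if_False)
    qed
    finally show ?thesis .
  qed
  have "\<phi> \<in> hom ?\<pi> (G\<lparr>carrier := Gamma_Omega G R s\<rparr>)"
  proof (rule homI)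
    fix A assume "A \<in> carrier ?\<pi>"
    then obtain \<gamma> where "\<gamma> \<in> ?L" "A = ?c \<gamma>" unfolding car by blast
    then show "\<phi> A \<in> carrier (G\<lparr>carrier := Gamma_Omega G R s\<rparr>)"
      using \<phi> Gamma_Omega_eq(1)[OF s] by simp
  next
    fix A B assume "A \<in> carrier ?\<pi>" "B \<in> carrier ?\<pi>"
    then obtain \<gamma> \<delta> where "\<gamma> \<in> ?L" "A = ?c \<gamma>" "\<delta> \<in> ?L" "B = ?c \<delta>" unfolding car by blast
    then show "\<phi> (A \<otimes>\<^bsub>?\<pi>\<^esub> B) = \<phi> A \<otimes>\<^bsub>G\<lparr>carrier := Gamma_Omega G R s\<rparr>\<^esub> \<phi> B"
      using \<phi> app mult by simp
  qed
  moreover have "inj_on \<phi> (carrier ?\<pi>)"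
  proof (rule inj_onI)
    fix A B assume "A \<in> carrier ?\<pi>" "B \<in> carrier ?\<pi>" "\<phi> A = \<phi> B"
    then show "A = B" using \<phi> cls by (auto simp: car)
  qed
  moreover have "\<phi> ` carrier ?\<pi> = Gamma_Omega G R s"
    unfolding car Gamma_Omega_eq(1)[OF s] image_image using \<phi> by (intro image_cong) auto
  ultimately show ?thesis using \<phi> by (auto simp: iso_def bij_betw_def)
qed

end

theorem corollary6:
  fixes W :: "('a, 'b) monoid_scheme" and S :: "'a set" and s :: 'a
  assumes "coxeter_system W S" and "s \<in> S"
  shows "coxeter_system (W\<lparr>carrier := W_Omega W S s\<rparr>) (path_reflections W S s)
    \<and> (\<exists>\<phi> \<in> iso (graph_fundamental_group S (odd_joined W S) s)
                 (W\<lparr>carrier := Gamma_Omega W S s\<rparr>).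
         \<forall>\<gamma> \<in> edge_loops S (odd_joined W S) s.
           \<phi> (loop_class S (odd_joined W S) s \<gamma>) = path_elt W \<gamma>)
    \<and> internal_direct_product W (centralizer W s)
         (generate W {s}) (W_Omega W S s <#>\<^bsub>W\<^esub> Gamma_Omega W S s)
    \<and> internal_semidirect_product W (W_Omega W S s <#>\<^bsub>W\<^esub> Gamma_Omega W S s)
         (W_Omega W S s) (Gamma_Omega W S s)"
proof -
  interpret group W using assms(1) by (simp add: coxeter_system_def)
  interpret coxeter W S by unfold_locales (rule assms(1))
  show ?thesis
    using reflection_cocycle.is_coxeter_system[OF W_Omega_reflection_cocycle[OF assms(2)]]
      fundamental_group_iso[OF assms(2)] direct_centralizer[OF assms(2)]
      semidirect_W_Omega_Gamma_Omega[OF assms(2)]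
    by (simp add: positive_centralizer_eq[OF assms(2)])
qed

end
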